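(* The following are equivalent: (1) There exists a (not necessarily continuous) linear map $E':c_{00}(\Sigma)\to C(X)'_1$ which is the identity on $C(X)'_{00}$ and is a morphism of left $C(X)$-modules. (2) There exists a (not necessarily continuous) linear map $E':c_{00}(\Sigma)\to C(X)'_1$ which is the identity on $C(X)'_{00}$ and is a morphism of right $C(X)$-modules. (3) The sets $\mathrm{Fix}_k(\sigma)^\circ$ are closed in $X$ for all $k\in\mathbb{Z}$. (4) There exists a faithful involutive norm one projection $E':\ell^1(\Sigma)\to C(X)'_1$ onto $C(X)'_1$, which is a morphism of $C(X)'_1$-bimodules, which restricts to a projection from $c_{00}(\Sigma)$ onto $C(X)'_{00}$, and which is positive in the sense that $\phi(E'(\ell))\ge0$ for all $\ell\in\ell^1(\Sigma)_+$ and all states $\phi$ of $C(X)'_1$.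
   Context: Let $X$ be a non-empty compact Hausdorff space and $\sigma:X\to X$ a homeomorphism; $\mathrm{Fix}_k(\sigma)=\{x:\sigma^kx=x\}$ and superscript $\circ$ denotes interior. $C(X)$ is the algebra of continuous complex functions with sup norm, $\alpha(f)=f\circ\sigma^{-1}$. $\ell^1(\Sigma)$ is the set of $\ell:\mathbb{Z}\to C(X)$ with $\|\ell\|=\sum_k\|\ell(k)\|_\infty<\infty$, product $(\ell\ell')(n)=\sum_k\ell(k)\alpha^k(\ell'(n-k))$, involution $\ell^*(n)=\overline{\alpha^n(\ell(-n))}$; it is a unital Banach $*$-algebra. With $\delta$ the element equal to the constant $1$ at $1\in\mathbb{Z}$ and $0$ elsewhere, elements are written $\sum_kf_k\delta^k$ ($f_k=\ell(k)$), and $C(X)$ is embedded as $\{f\delta^0\}$. $c_{00}(\Sigma)$ is the $*$-subalgebra of finite sums. $C(X)'_1$ and $C(X)'_{00}$ are the commutants of $C(X)$ in $\ell^1(\Sigma)$ and in $c_{00}(\Sigma)$. The positive cone $\ell^1(\Sigma)_+$ is the set of all finite sums $\sum_j\ell_j^*\ell_j$ with $\ell_j\in\ell^1(\Sigma)$; a linear map on $\ell^1(\Sigma)$ is faithful if $0$ is the only element of $\ell^1(\Sigma)_+$ in its kernel. A state of the unital Banach $*$-algebra $C(X)'_1$ is a positive linear functional $\phi$ ($\phi(a^*a)\ge0$) with $\phi(1)=1$. A projection onto $C(X)'_1$ is a linear idempotent map with range $C(X)'_1$; involutive means $E'(\ell^* )=E'(\ell)^*$. *)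

theory Defs
  imports "HOL-Analysis.Analysis"
begin

text \<open>Elements of l1(Sigma) are represented as functions int => (X => complex);
  the value at k is the coefficient f_k (a continuous function on X).
  The space X is the type 'a (class t2_space, with compact UNIV).\<close>

type_synonym 'a cp = "int \<Rightarrow> 'a \<Rightarrow> complex"

definition spow :: "('a \<Rightarrow> 'a) \<Rightarrow> int \<Rightarrow> 'a \<Rightarrow> 'a" where
  "spow \<sigma> k = (if 0 \<le> k then \<sigma> ^^ nat k else (inv \<sigma>) ^^ nat (- k))"

definition alpha_pow :: "('a \<Rightarrow> 'a) \<Rightarrow> int \<Rightarrow> ('a \<Rightarrow> complex) \<Rightarrow> 'a \<Rightarrow> complex" where
  "alpha_pow \<sigma> k f = f \<circ> spow \<sigma> (- k)"

definition Fix :: "('a \<Rightarrow> 'a) \<Rightarrow> int \<Rightarrow> 'a set" where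
  "Fix \<sigma> k = {x. spow \<sigma> k x = x}"

definition CX :: "('a::topological_space \<Rightarrow> complex) set" where
  "CX = {f. continuous_on UNIV f}"

definition supnorm :: "('a \<Rightarrow> complex) \<Rightarrow> real" where
  "supnorm f = (SUP x. norm (f x))"

definition l1 :: "'a::topological_space cp set" where
  "l1 = {l. (\<forall>k. l k \<in> CX) \<and> (\<lambda>k. supnorm (l k)) summable_on UNIV}"

definition l1norm :: "'a cp \<Rightarrow> real" where
  "l1norm l = (\<Sum>\<^sub>\<infinity>k. supnorm (l k))"

definition c00 :: "'a::topological_space cp set" where
  "c00 = {l \<in> l1. finite {k. l k \<noteq> (\<lambda>x. 0)}}"

definition cadd :: "'a cp \<Rightarrow> 'a cp \<Rightarrow> 'a cp" where
  "cadd l l' = (\<lambda>k x. l k x + l' k x)"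

definition cscale :: "complex \<Rightarrow> 'a cp \<Rightarrow> 'a cp" where
  "cscale c l = (\<lambda>k x. c * l k x)"

text \<open>Twisted convolution product (l l')(n) = sum_k l(k) alpha^k(l'(n-k)), the
  series in C(X) being absolutely convergent; we evaluate it pointwise.\<close>
definition cmult :: "('a \<Rightarrow> 'a) \<Rightarrow> 'a cp \<Rightarrow> 'a cp \<Rightarrow> 'a cp" where
  "cmult \<sigma> l l' = (\<lambda>n x. \<Sum>\<^sub>\<infinity>k. l k x * alpha_pow \<sigma> k (l' (n - k)) x)"

definition cstar :: "('a \<Rightarrow> 'a) \<Rightarrow> 'a cp \<Rightarrow> 'a cp" where
  "cstar \<sigma> l = (\<lambda>n x. cnj (alpha_pow \<sigma> n (l (- n)) x))"

definition emb :: "('a \<Rightarrow> complex) \<Rightarrow> 'a cp" where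
  "emb f = (\<lambda>k. if k = 0 then f else (\<lambda>x. 0))"

definition cone :: "'a cp" where
  "cone = emb (\<lambda>x. 1)"

definition comm1 :: "('a::topological_space \<Rightarrow> 'a) \<Rightarrow> 'a cp set" where
  "comm1 \<sigma> = {l \<in> l1. \<forall>f \<in> CX. cmult \<sigma> (emb f) l = cmult \<sigma> l (emb f)}"

definition comm00 :: "('a::topological_space \<Rightarrow> 'a) \<Rightarrow> 'a cp set" where
  "comm00 \<sigma> = comm1 \<sigma> \<inter> c00"

inductive_set poscone :: "('a::topological_space \<Rightarrow> 'a) \<Rightarrow> 'a cp set" for \<sigma> where
  zero: "(\<lambda>k x. 0) \<in> poscone \<sigma>"
| step: "l \<in> l1 \<Longrightarrow> p \<in> poscone \<sigma> \<Longrightarrow> cadd (cmult \<sigma> (cstar \<sigma> l) l) p \<in> poscone \<sigma>"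

definition lin_on :: "'a cp set \<Rightarrow> ('a cp \<Rightarrow> 'b cp) \<Rightarrow> bool" where
  "lin_on A E \<longleftrightarrow> (\<forall>l\<in>A. \<forall>l'\<in>A. E (cadd l l') = cadd (E l) (E l'))
                  \<and> (\<forall>l\<in>A. \<forall>c. E (cscale c l) = cscale c (E l))"

definition state :: "('a::topological_space \<Rightarrow> 'a) \<Rightarrow> ('a cp \<Rightarrow> complex) \<Rightarrow> bool" where
  "state \<sigma> \<phi> \<longleftrightarrow>
     (\<forall>a\<in>comm1 \<sigma>. \<forall>b\<in>comm1 \<sigma>. \<phi> (cadd a b) = \<phi> a + \<phi> b)
   \<and> (\<forall>a\<in>comm1 \<sigma>. \<forall>c. \<phi> (cscale c a) = c * \<phi> a)
   \<and> (\<forall>a\<in>comm1 \<sigma>. Im (\<phi> (cmult \<sigma> (cstar \<sigma> a) a)) = 0 \<and> Re (\<phi> (cmult \<sigma> (cstar \<sigma> a) a)) \<ge> 0)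
   \<and> \<phi> cone = 1"

end

theory Submission
  imports Defs "HOL-Library.Function_Algebras"
begin

text \<open>
  Write \<open>F k\<close> for the interior of \<open>Fix\<^sub>k(\<sigma>)\<close>.  By Urysohn's lemma, \<open>l\<close> commutes with \<open>C(X)\<close> iff
  each \<open>l k\<close> vanishes off \<open>F k\<close>.  If \<open>E'\<close> is a one-sided module map as in (1) or (2), the \<open>k\<close>-th
  coefficient of \<open>E' \<delta>\<^sup>k\<close> is a continuous function equal to \<open>1\<close> on \<open>F k\<close> and to \<open>0\<close> off it, so \<open>F k\<close> is
  closed.  Conversely, if all \<open>F k\<close> are clopen, \<open>E\<close> multiplies \<open>l k\<close> by the indicator of \<open>F k\<close>.

  The delicate point is positivity.  For \<open>l\<close> with finite support, \<open>E (l\<^sup>* l)\<close> is a finite sum of squares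
  from the commutant: for fixed \<open>x\<close>, the relation \<open>x \<in> F (i - j)\<close> is an equivalence on the support,
  and \<open>E\<close> keeps the products within its classes.  The general case follows by truncation, because
  \<open>1 - h\<close> is a square in the commutant for small self-adjoint \<open>h\<close> (solve \<open>2 y = h + y\<^sup>2\<close> by iteration), so
  that states are automatically bounded below by \<open>- 4 \<parallel>h\<parallel>\<close> on self-adjoint elements.
\<close>

subsection \<open>Dominated sums\<close>

lemma summable_on_infsum_dominated:
  fixes f :: "'i \<Rightarrow> complex"
  assumes "B summable_on A" and "\<And>i. i \<in> A \<Longrightarrow> norm (f i) \<le> B i"
  shows "f summable_on A" and "norm (infsum f A) \<le> infsum B A"
proof -
  have "(\<lambda>i. norm (f i)) summable_on A"
    by (rule summable_on_comparison_test[OF assms(1)]) (use assms(2) in auto)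
  then show *: "f summable_on A"
    using abs_summable_summable by blast
  show "norm (infsum f A) \<le> infsum B A"
    by (rule norm_infsum_le[OF has_sum_infsum[OF *] has_sum_infsum[OF assms(1)]]) (use assms in auto)
qed

text \<open>Weierstrass M-test: the dominating family makes the finite partial sums converge
  uniformly, and a uniform limit of continuous functions is continuous.\<close>

lemma continuous_on_infsum:
  fixes f :: "'i \<Rightarrow> 'a::topological_space \<Rightarrow> complex"
  assumes "\<And>i. i \<in> A \<Longrightarrow> continuous_on S (f i)"
    and "B summable_on A" and "\<And>i x. i \<in> A \<Longrightarrow> x \<in> S \<Longrightarrow> norm (f i x) \<le> B i"
  shows "continuous_on S (\<lambda>x. \<Sum>\<^sub>\<infinity>i\<in>A. f i x)"
proof (rule uniform_limit_theorem)
  show "uniform_limit S (\<lambda>Y x. \<Sum>i\<in>Y. f i x) (\<lambda>x. \<Sum>\<^sub>\<infinity>i\<in>A. f i x) (finite_subsets_at_top A)"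
    by (rule Weierstrass_m_test_general) (use assms in auto)
  show "\<forall>\<^sub>F Y in finite_subsets_at_top A. continuous_on S (\<lambda>x. \<Sum>i\<in>Y. f i x)"
    by (rule eventually_finite_subsets_at_top_weakI)
      (use assms(1) in \<open>auto intro!: continuous_on_sum\<close>)
qed auto

lemma supnorm_le: "(\<And>x. norm (f x) \<le> B) \<Longrightarrow> supnorm f \<le> B"
  unfolding supnorm_def by (rule cSUP_least) auto

lemma l1I:
  assumes "\<And>k. continuous_on UNIV (l k)" and "B summable_on UNIV" and "\<And>k x. norm (l k x) \<le> B k"
  shows "l \<in> l1" and "l1norm l \<le> infsum B UNIV"
proof -
  \<comment> \<open>A real supremum is informative only over a bounded set; the bound by
    \<open>B k\<close> supplies this, without any appeal to compactness.\<close>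
  have nn: "0 \<le> supnorm (l k)" for k
  proof -
    have "bdd_above (range (\<lambda>x. norm (l k x)))"
      using assms(3)[of k] by (auto simp: bdd_above_def)
    then have "norm (l k undefined) \<le> supnorm (l k)"
      unfolding supnorm_def by (intro cSUP_upper) auto
    then show ?thesis by (meson norm_ge_zero order_trans)
  qed
  have s: "(\<lambda>k. supnorm (l k)) summable_on UNIV"
    by (rule summable_on_comparison_test[OF assms(2)]) (auto intro: supnorm_le assms(3) nn)
  then show "l \<in> l1" using assms(1) by (auto simp: l1_def CX_def)
  show "l1norm l \<le> infsum B UNIV"
    unfolding l1norm_def by (rule infsum_mono[OF s assms(2)]) (auto intro: supnorm_le assms(3))
qed

text \<open>Identifies the explicit addition with the pointwise group structure on functions, which
  makes group and finite-sum rules available; \<open>zero_cp\<close> does the same for zero.\<close>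

lemma cadd_eq_plus: "cadd = (+)"
  by (auto simp: cadd_def fun_eq_iff)

lemma zero_cp: "(\<lambda>k x. 0) = (0 :: 'a cp)"
  by (auto simp: fun_eq_iff)

lemma sum_cp_apply: "(\<Sum>j\<in>J. c j) k x = (\<Sum>j\<in>J. c j k x)" for c :: "'j \<Rightarrow> 'a cp"
  by (induction J rule: infinite_finite_induct) auto

lemma emb_apply: "emb f k x = (if k = 0 then f x else 0)"
  by (simp add: emb_def)

subsection \<open>Interiors of the fixed point sets\<close>

locale compact_dynamical_system =
  fixes \<sigma> \<tau> :: "'a::t2_space \<Rightarrow> 'a"
  assumes compact_UNIV: "compact (UNIV :: 'a set)"
    and homeo: "homeomorphism (UNIV :: 'a set) UNIV \<sigma> \<tau>"
begin

lemma sigma_tau: "\<sigma> (\<tau> x) = x" and tau_sigma: "\<tau> (\<sigma> x) = x"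
  using homeo by (auto simp: homeomorphism_def)

lemma inv_sigma: "inv \<sigma> = \<tau>"
  by (rule inv_unique_comp) (auto simp: fun_eq_iff sigma_tau tau_sigma)

lemma spow_0 [simp]: "spow \<sigma> 0 x = x"
  by (simp add: spow_def)

text \<open>\<open>spow\<close> is defined by the sign of the exponent. This one-step law hides the
  split, so that the group law and continuity follow by integer induction.\<close>

lemma spow_Suc: "spow \<sigma> (k + 1) x = \<sigma> (spow \<sigma> k x)"
proof (cases "0 \<le> k")
  case True
  then have "nat (k + 1) = Suc (nat k)" by auto
  then show ?thesis using True by (simp add: spow_def)
next
  case False
  define m where "m = nat (- (k + 1))"
  have m: "nat (- k) = Suc m" "nat (- (k + 1)) = m"
    using False by (auto simp: m_def)
  show ?thesis
  \<comment> \<open>The passage from exponent -1 to 0 is the only one that changes the branch of the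
    definition.\<close>
  proof (cases "k = -1")
    case True then show ?thesis by (simp add: spow_def inv_sigma sigma_tau)
  next
    case k: False
    then have "\<not> 0 \<le> k + 1" using False by auto
    then have "spow \<sigma> (k+1) x = (\<tau> ^^ m) x" using m(2) by (simp add: spow_def inv_sigma)
    moreover have "spow \<sigma> k x = (\<tau> ^^ Suc m) x" using m(1) False by (simp add: spow_def inv_sigma)
    ultimately show ?thesis by (simp add: sigma_tau)
  qed
qed

lemma spow_pred: "spow \<sigma> (k - 1) x = \<tau> (spow \<sigma> k x)"
  using spow_Suc[of "k - 1" x] by (simp add: tau_sigma)

lemma spow_add: "spow \<sigma> (m + n) x = spow \<sigma> m (spow \<sigma> n x)"
proof (induction m rule: int_induct[where k = 0])
  case base then show ?case by simp
next
  case (step1 i)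
  have "i + 1 + n = (i + n) + 1" by simp
  then show ?case using step1 by (simp only: spow_Suc)
next
  case (step2 i)
  have "i - 1 + n = (i + n) - 1" by simp
  then show ?case using step2 by (simp only: spow_pred)
qed

lemma spow_spow_minus [simp]: "spow \<sigma> k (spow \<sigma> (- k) x) = x" "spow \<sigma> (- k) (spow \<sigma> k x) = x"
  by (simp_all flip: spow_add)

lemma continuous_on_spow: "continuous_on UNIV (spow \<sigma> k)"
proof (induction k rule: int_induct[where k = 0])
  case base
  then show ?case by (simp add: spow_def)
next
  case (step1 i)
  have "continuous_on UNIV \<sigma>" using homeo by (simp add: homeomorphism_def)
  then have "continuous_on UNIV (\<lambda>x. \<sigma> (spow \<sigma> i x))"
    using step1(2) by (rule continuous_on_compose2) auto
  then show ?case by (simp add: spow_Suc[abs_def] cong: continuous_on_cong)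
next
  case (step2 i)
  have "continuous_on UNIV \<tau>" using homeo by (simp add: homeomorphism_def)
  then have "continuous_on UNIV (\<lambda>x. \<tau> (spow \<sigma> i x))"
    using step2(2) by (rule continuous_on_compose2) auto
  then show ?case by (simp add: spow_pred[abs_def] cong: continuous_on_cong)
qed

lemma continuous_on_comp_spow: "continuous_on UNIV f \<Longrightarrow> continuous_on UNIV (\<lambda>x. f (spow \<sigma> k x))"
  by (rule continuous_on_compose2[OF _ continuous_on_spow]) auto

abbreviation F :: "int \<Rightarrow> 'a set" where "F k \<equiv> interior (Fix \<sigma> k)"

lemma F_fixed: "x \<in> F k \<Longrightarrow> spow \<sigma> k x = x"
  using interior_subset by (auto simp: Fix_def)

lemma Fix_minus: "Fix \<sigma> (- k) = Fix \<sigma> k"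
  unfolding Fix_def by (metis spow_spow_minus)

lemma F_minus [simp]: "F (- k) = F k"
  by (simp add: Fix_minus)

lemma F_fixed_minus: "x \<in> F k \<Longrightarrow> spow \<sigma> (- k) x = x"
  by (rule F_fixed) simp

lemma F_0 [simp]: "F 0 = UNIV"
  by (simp add: Fix_def)

text \<open>Interiors commute with finite intersections. Together with \<open>F_0\<close> and
  \<open>F_minus\<close>, this makes the set of \<open>k\<close> with \<open>x \<in> F k\<close> a
  subgroup of the integers for each \<open>x\<close>.\<close>

lemma F_add: "x \<in> F m \<Longrightarrow> x \<in> F n \<Longrightarrow> x \<in> F (m + n)"
proof -
  assume "x \<in> F m" "x \<in> F n"
  then have "x \<in> interior (Fix \<sigma> m \<inter> Fix \<sigma> n)" by simp
  moreover have "Fix \<sigma> m \<inter> Fix \<sigma> n \<subseteq> Fix \<sigma> (m + n)" by (auto simp: Fix_def spow_add)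
  ultimately show ?thesis using interior_mono by blast
qed

lemma F_diff: "x \<in> F m \<Longrightarrow> x \<in> F n \<Longrightarrow> x \<in> F (m - n)"
  using F_add[of x m "- n"] by simp

lemma F_diff_iff: "x \<in> F m \<Longrightarrow> x \<in> F (n - m) \<longleftrightarrow> x \<in> F n"
  using F_add[of x m "n - m"] F_diff[of x n m] by auto

lemma F_diff_commute: "F (m - n) = F (n - m)"
  using F_minus[of "m - n"] by simp

text \<open>Powers of \<sigma> commute, so the preimage of \<open>F k\<close> under
  \<open>spow \<sigma> j\<close> is an open subset of \<open>Fix \<sigma> k\<close>. Hence
  \<open>F k\<close> is invariant under the whole action.\<close>

lemma F_spow_imp: "spow \<sigma> j x \<in> F k \<Longrightarrow> x \<in> F k"
proof -
  assume a: "spow \<sigma> j x \<in> F k"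
  have "open (spow \<sigma> j -` F k)"
    using continuous_on_spow by (simp add: continuous_on_open_vimage)
  moreover have "spow \<sigma> j -` F k \<subseteq> Fix \<sigma> k"
  proof
    fix y assume "y \<in> spow \<sigma> j -` F k"
    then have "spow \<sigma> k (spow \<sigma> j y) = spow \<sigma> j y" using F_fixed by auto
    then have "spow \<sigma> j (spow \<sigma> k y) = spow \<sigma> j y"
      by (simp flip: spow_add add: add.commute)
    then show "y \<in> Fix \<sigma> k" unfolding Fix_def by (metis (mono_tags) mem_Collect_eq spow_spow_minus(2))
  qed
  ultimately show ?thesis using a interior_maximal by blast
qed

lemma F_spow [simp]: "spow \<sigma> j x \<in> F k \<longleftrightarrow> x \<in> F k"
  using F_spow_imp[of j x k] F_spow_imp[of "- j" "spow \<sigma> j x" k] by auto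

subsection \<open>The convolution algebra\<close>

text \<open>Compactness bounds the range, which turns the supremum into a true upper bound.\<close>

lemma norm_le_supnorm: "continuous_on UNIV f \<Longrightarrow> norm (f x) \<le> supnorm f" for f :: "'a \<Rightarrow> complex"
proof -
  assume "continuous_on UNIV f"
  then have "compact (range (\<lambda>x. norm (f x)))"
    using compact_UNIV by (intro compact_continuous_image continuous_on_norm)
  then have "bdd_above (range (\<lambda>x. norm (f x)))"
    by (intro bounded_imp_bdd_above compact_imp_bounded)
  then show ?thesis unfolding supnorm_def by (intro cSUP_upper) auto
qed

lemma l1_continuous: "l \<in> l1 \<Longrightarrow> continuous_on UNIV (l k)" for l :: "'a cp"
  by (simp add: l1_def CX_def)

lemma l1_norm_le: "l \<in> l1 \<Longrightarrow> norm (l k x) \<le> supnorm (l k)" for l :: "'a cp"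
  by (rule norm_le_supnorm) (rule l1_continuous)

lemma l1_summable: "l \<in> l1 \<Longrightarrow> (\<lambda>k. supnorm (l k)) summable_on UNIV" for l :: "'a cp"
  by (simp add: l1_def)

lemma supnorm_nonneg: "l \<in> l1 \<Longrightarrow> 0 \<le> supnorm (l k)" for l :: "'a cp"
  by (meson l1_norm_le norm_ge_zero order_trans)

lemma l1norm_nonneg: "l \<in> l1 \<Longrightarrow> 0 \<le> l1norm l" for l :: "'a cp"
  unfolding l1norm_def by (rule infsum_nonneg) (rule supnorm_nonneg)

lemma l1norm_zero_imp: "l \<in> l1 \<Longrightarrow> l1norm l \<le> 0 \<Longrightarrow> l = 0" for l :: "'a cp"
proof (intro ext)
  fix k x
  assume l: "l \<in> l1" "l1norm l \<le> 0"
  have "supnorm (l k) = 0"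
    by (rule nonneg_infsum_le_0D[of "\<lambda>k. supnorm (l k)" UNIV])
      (use l l1_summable supnorm_nonneg in \<open>auto simp: l1norm_def\<close>)
  then show "l k x = 0 k x" using l1_norm_le[OF l(1), of k x] by simp
qed

text \<open>Fubini for the sup norms over pairs \<open>(i, k)\<close>. This is the form in which
  completeness of \<open>l1\<close> is used: for the product, and for the limit of an iteration in
  the commutant.\<close>

lemma l1_infsum:
  fixes d :: "'i \<Rightarrow> 'a cp"
  assumes d: "\<And>i. i \<in> A \<Longrightarrow> d i \<in> l1" and B: "B summable_on A"
    and dB: "\<And>i. i \<in> A \<Longrightarrow> l1norm (d i) \<le> B i"
  shows "(\<lambda>k x. \<Sum>\<^sub>\<infinity>i\<in>A. d i k x) \<in> l1"
    and "l1norm (\<lambda>k x. \<Sum>\<^sub>\<infinity>i\<in>A. d i k x) \<le> infsum B A"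
    and "\<And>k x. (\<lambda>i. d i k x) summable_on A"
proof -
  define D where "D = (\<lambda>(i, k). supnorm (d i k))"
  have sN: "(\<lambda>i. l1norm (d i)) summable_on A"
    by (rule summable_on_comparison_test[OF B]) (auto simp: d dB l1norm_nonneg)
  \<comment> \<open>Joint summability over pairs yields both the sums over \<open>i\<close> at fixed
    \<open>k\<close> and the right to exchange the two summations.\<close>
  have sD: "D summable_on A \<times> UNIV"
    by (rule summable_on_SigmaI[OF _ sN])
      (auto simp: D_def l1norm_def intro!: has_sum_infsum l1_summable supnorm_nonneg d)
  have sk: "(\<lambda>i. supnorm (d i k)) summable_on A" for k
  proof -
    have "(\<lambda>(k,i). D (i,k)) summable_on UNIV \<times> A"
      using sD by (subst summable_on_swap) (auto simp: case_prod_unfold)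
    then have "(\<lambda>i. D (i, k)) summable_on A"
      by (rule summable_on_SigmaD1[where f = "\<lambda>k i. D (i, k)" and B = "\<lambda>_. A"])
        (auto simp: D_def supnorm_nonneg d)
    then show ?thesis by (simp add: D_def)
  qed
  let ?M = "\<lambda>k. \<Sum>\<^sub>\<infinity>i\<in>A. supnorm (d i k)"
  have sM: "?M summable_on UNIV"
  proof -
    have "(\<lambda>(k,i). D (i,k)) summable_on UNIV \<times> A"
      using sD by (subst summable_on_swap) (auto simp: case_prod_unfold)
    from summable_on_Sigma_banach[OF this] show ?thesis by (simp add: D_def)
  qed
  have c: "continuous_on UNIV (\<lambda>x. \<Sum>\<^sub>\<infinity>i\<in>A. d i k x)" for k
    by (rule continuous_on_infsum[OF _ sk[of k]]) (auto simp: d l1_continuous l1_norm_le)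
  have b: "norm (\<Sum>\<^sub>\<infinity>i\<in>A. d i k x) \<le> ?M k" for k x
    by (rule summable_on_infsum_dominated[OF sk[of k]]) (auto simp: d l1_norm_le)
  show "(\<lambda>i. d i k x) summable_on A" for k x
    by (rule summable_on_infsum_dominated[OF sk[of k]]) (auto simp: d l1_norm_le)
  show "(\<lambda>k x. \<Sum>\<^sub>\<infinity>i\<in>A. d i k x) \<in> l1"
    by (rule l1I[OF c sM b])
  have "l1norm (\<lambda>k x. \<Sum>\<^sub>\<infinity>i\<in>A. d i k x) \<le> infsum ?M UNIV"
    by (rule l1I[OF c sM b])
  also have "\<dots> = (\<Sum>\<^sub>\<infinity>i\<in>A. l1norm (d i))"
    using infsum_swap_banach[of "\<lambda>i k. D (i, k)" A UNIV] sD by (simp add: D_def l1norm_def)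
  also have "\<dots> \<le> infsum B A" by (rule infsum_mono[OF sN B dB])
  finally show "l1norm (\<lambda>k x. \<Sum>\<^sub>\<infinity>i\<in>A. d i k x) \<le> infsum B A" .
qed

section \<open>Linear operations on \<open>l1\<close>\<close>

lemma l1_zero: "(0 :: 'a cp) \<in> l1"
  by (rule l1I[where B = "\<lambda>_. 0"]) (auto simp: zero_fun_def)

lemma l1_add:
  fixes a b :: "'a cp"
  assumes "a \<in> l1" "b \<in> l1"
  shows "a + b \<in> l1" "l1norm (a + b) \<le> l1norm a + l1norm b"
proof -
  have s: "(\<lambda>k. supnorm (a k) + supnorm (b k)) summable_on UNIV"
    using assms by (intro summable_on_add l1_summable)
  have c: "continuous_on UNIV ((a + b) k)" for k
    using assms by (simp add: plus_fun_def continuous_on_add l1_continuous)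
  have n: "norm ((a + b) k x) \<le> supnorm (a k) + supnorm (b k)" for k x
    using l1_norm_le[OF assms(1), of k x] l1_norm_le[OF assms(2), of k x]
    by simp norm
  show "a + b \<in> l1" by (rule l1I[OF c s n])
  have "l1norm (a + b) \<le> (\<Sum>\<^sub>\<infinity>k. supnorm (a k) + supnorm (b k))" by (rule l1I[OF c s n])
  then show "l1norm (a + b) \<le> l1norm a + l1norm b"
    using assms by (simp add: l1norm_def infsum_add l1_summable)
qed

lemma l1_cscale:
  fixes a :: "'a cp"
  assumes "a \<in> l1"
  shows "cscale c a \<in> l1" "l1norm (cscale c a) \<le> norm c * l1norm a"
proof -
  have s: "(\<lambda>k. norm c * supnorm (a k)) summable_on UNIV"
    using assms by (intro summable_on_cmult_right l1_summable)
  have co: "continuous_on UNIV (cscale c a k)" for k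
    using assms by (simp add: cscale_def continuous_on_mult_left l1_continuous)
  have n: "norm (cscale c a k x) \<le> norm c * supnorm (a k)" for k x
    using l1_norm_le[OF assms, of k x] by (auto simp: cscale_def norm_mult intro!: mult_left_mono)
  show "cscale c a \<in> l1" by (rule l1I[OF co s n])
  have "l1norm (cscale c a) \<le> (\<Sum>\<^sub>\<infinity>k. norm c * supnorm (a k))" by (rule l1I[OF co s n])
  then show "l1norm (cscale c a) \<le> norm c * l1norm a"
    by (simp add: l1norm_def infsum_cmult_right')
qed

lemma uminus_eq_cscale: "- a = cscale (- 1) a" for a :: "'a cp"
  by (auto simp: cscale_def fun_eq_iff)

lemma l1_uminus:
  fixes a :: "'a cp"
  assumes "a \<in> l1"
  shows "- a \<in> l1" "l1norm (- a) \<le> l1norm a"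
  using l1_cscale[OF assms, of "- 1"] by (auto simp: uminus_eq_cscale)

lemma l1_diff:
  fixes a b :: "'a cp"
  assumes "a \<in> l1" "b \<in> l1"
  shows "a - b \<in> l1" "l1norm (a - b) \<le> l1norm a + l1norm b"
  using l1_add[OF assms(1) l1_uminus(1)[OF assms(2)]] l1_uminus[OF assms(2)] by auto

section \<open>Twisted convolution and involution\<close>

lemma cmult_apply: "cmult \<sigma> a b n x = (\<Sum>\<^sub>\<infinity>k. a k x * b (n - k) (spow \<sigma> (- k) x))"
  by (simp add: cmult_def alpha_pow_def)

lemma cstar_apply: "cstar \<sigma> a n x = cnj (a (- n) (spow \<sigma> (- n) x))"
  by (simp add: cstar_def alpha_pow_def)

lemma cmult_l1:
  fixes a b :: "'a cp"
  assumes "a \<in> l1" "b \<in> l1"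
  shows "cmult \<sigma> a b \<in> l1" "l1norm (cmult \<sigma> a b) \<le> l1norm a * l1norm b"
    "\<And>n x. (\<lambda>k. a k x * b (n - k) (spow \<sigma> (- k) x)) summable_on UNIV"
proof -
  \<comment> \<open>\<open>d k\<close> is the product of the single term \<open>a k\<close> at
    degree \<open>k\<close> with \<open>b\<close>. Its norm is at most
    \<open>supnorm (a k) * l1norm b\<close>, so the product is a norm-convergent series of such
    elements.\<close>
  define d where "d = (\<lambda>k n x. a k x * b (n - k) (spow \<sigma> (- k) x))"
  have bij: "bij_betw (\<lambda>n::int. n - k) UNIV UNIV" for k
    by (rule bij_betw_byWitness[where f' = "\<lambda>n. n + k"]) auto
  have sb: "(\<lambda>n. supnorm (a k) * supnorm (b (n - k))) summable_on UNIV" for k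
    using summable_on_reindex_bij_betw[OF bij[of k], of "\<lambda>n. supnorm (b n)"] l1_summable[OF assms(2)]
    by (intro summable_on_cmult_right) simp
  have c: "continuous_on UNIV (d k n)" for k n
    unfolding d_def using assms by (intro continuous_intros continuous_on_comp_spow l1_continuous)
  have nb: "norm (d k n x) \<le> supnorm (a k) * supnorm (b (n - k))" for k n x
    unfolding d_def norm_mult using assms
    by (intro mult_mono l1_norm_le supnorm_nonneg) auto
  have dl: "d k \<in> l1" for k
    by (rule l1I[OF c sb nb])
  have dn: "l1norm (d k) \<le> supnorm (a k) * l1norm b" for k
  proof -
    have "l1norm (d k) \<le> (\<Sum>\<^sub>\<infinity>n. supnorm (a k) * supnorm (b (n - k)))"
      by (rule l1I[OF c sb nb])
    also have "\<dots> = supnorm (a k) * l1norm b"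
      using infsum_reindex_bij_betw[OF bij[of k], of "\<lambda>n. supnorm (b n)"]
      by (simp add: infsum_cmult_right' l1norm_def)
    finally show ?thesis .
  qed
  have sB: "(\<lambda>k. supnorm (a k) * l1norm b) summable_on UNIV"
    using assms by (intro summable_on_cmult_left l1_summable)
  have eq: "cmult \<sigma> a b = (\<lambda>n x. \<Sum>\<^sub>\<infinity>k. d k n x)"
    by (auto simp: fun_eq_iff cmult_apply d_def)
  show "cmult \<sigma> a b \<in> l1"
    unfolding eq by (rule l1_infsum(1)[OF dl sB dn])
  have "l1norm (cmult \<sigma> a b) \<le> (\<Sum>\<^sub>\<infinity>k. supnorm (a k) * l1norm b)"
    unfolding eq by (rule l1_infsum(2)[OF dl sB dn])
  then show "l1norm (cmult \<sigma> a b) \<le> l1norm a * l1norm b"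
    by (simp add: infsum_cmult_left' l1norm_def)
  show "(\<lambda>k. a k x * b (n - k) (spow \<sigma> (- k) x)) summable_on UNIV" for n x
    using l1_infsum(3)[OF dl sB dn, of n x] by (simp add: d_def)
qed

text \<open>A divergent \<open>infsum\<close> defaults to zero, so additivity needs the summability
  from \<open>cmult_l1(3)\<close>; hence the membership hypotheses here and in the next three
  lemmas.\<close>

lemma cmult_add_left: "a \<in> l1 \<Longrightarrow> a' \<in> l1 \<Longrightarrow> b \<in> l1 \<Longrightarrow> cmult \<sigma> (a + a') b = cmult \<sigma> a b + cmult \<sigma> a' b"
  for a a' b :: "'a cp"
  by (auto simp: fun_eq_iff cmult_apply distrib_right infsum_add[OF cmult_l1(3) cmult_l1(3)])

lemma cmult_add_right: "a \<in> l1 \<Longrightarrow> b \<in> l1 \<Longrightarrow> b' \<in> l1 \<Longrightarrow> cmult \<sigma> a (b + b') = cmult \<sigma> a b + cmult \<sigma> a b'"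
  for a b b' :: "'a cp"
  by (auto simp: fun_eq_iff cmult_apply distrib_left infsum_add[OF cmult_l1(3) cmult_l1(3)])

lemma cmult_diff_left: "a \<in> l1 \<Longrightarrow> a' \<in> l1 \<Longrightarrow> b \<in> l1 \<Longrightarrow> cmult \<sigma> (a - a') b = cmult \<sigma> a b - cmult \<sigma> a' b"
  for a a' b :: "'a cp"
  using cmult_add_left[of "a - a'" a' b] by (simp add: l1_diff algebra_simps)

lemma cmult_diff_right: "a \<in> l1 \<Longrightarrow> b \<in> l1 \<Longrightarrow> b' \<in> l1 \<Longrightarrow> cmult \<sigma> a (b - b') = cmult \<sigma> a b - cmult \<sigma> a b'"
  for a b b' :: "'a cp"
  using cmult_add_right[of a "b - b'" b'] by (simp add: l1_diff algebra_simps)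

lemma cstar_l1:
  fixes a :: "'a cp"
  assumes "a \<in> l1"
  shows "cstar \<sigma> a \<in> l1" "l1norm (cstar \<sigma> a) \<le> l1norm a"
proof -
  have bij: "bij_betw (\<lambda>n::int. - n) UNIV UNIV"
    by (rule bij_betw_byWitness[where f' = "\<lambda>n. - n"]) auto
  have s: "(\<lambda>n. supnorm (a (- n))) summable_on UNIV"
    using summable_on_reindex_bij_betw[OF bij, of "\<lambda>n. supnorm (a n)"] l1_summable[OF assms] by simp
  have c: "continuous_on UNIV (cstar \<sigma> a k)" for k
    unfolding cstar_apply[abs_def]
    using assms by (intro continuous_intros continuous_on_comp_spow l1_continuous)
  have n: "norm (cstar \<sigma> a k x) \<le> supnorm (a (- k))" for k x
    using assms by (simp add: cstar_apply l1_norm_le)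
  show "cstar \<sigma> a \<in> l1" by (rule l1I[OF c s n])
  have "l1norm (cstar \<sigma> a) \<le> (\<Sum>\<^sub>\<infinity>n. supnorm (a (- n)))" by (rule l1I[OF c s n])
  also have "\<dots> = l1norm a"
    using infsum_reindex_bij_betw[OF bij, of "\<lambda>n. supnorm (a n)"] by (simp add: l1norm_def)
  finally show "l1norm (cstar \<sigma> a) \<le> l1norm a" .
qed

lemma cstar_add: "cstar \<sigma> (a + b) = cstar \<sigma> a + cstar \<sigma> b"
  by (auto simp: fun_eq_iff cstar_apply)

lemma cstar_diff: "cstar \<sigma> (a - b) = cstar \<sigma> a - cstar \<sigma> b"
  by (auto simp: fun_eq_iff cstar_apply)

lemma cstar_cscale: "cstar \<sigma> (cscale c a) = cscale (cnj c) (cstar \<sigma> a)"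
  by (auto simp: fun_eq_iff cstar_apply cscale_def)

lemma cstar_cstar: "cstar \<sigma> (cstar \<sigma> a) = a"
  using spow_spow_minus(1) by (auto simp: fun_eq_iff cstar_apply)

text \<open>Conjugation passes through \<open>infsum\<close> whether or not the sum converges, and
  the substitution of \<open>k + n\<close> for \<open>k\<close> is a bijection, so arbitrary
  coefficient families are covered.\<close>

lemma cstar_cmult: "cstar \<sigma> (cmult \<sigma> a b) = cmult \<sigma> (cstar \<sigma> b) (cstar \<sigma> a)"
proof (intro ext)
  fix n x
  have bij: "bij_betw (\<lambda>k::int. k + n) UNIV UNIV"
    by (rule bij_betw_byWitness[where f' = "\<lambda>k. k - n"]) auto
  show "cstar \<sigma> (cmult \<sigma> a b) n x = cmult \<sigma> (cstar \<sigma> b) (cstar \<sigma> a) n x"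
    unfolding cstar_apply cmult_apply infsum_cnj[symmetric]
  proof (subst infsum_reindex_bij_betw[OF bij, of "\<lambda>k. cnj (b (- k) (spow \<sigma> (- k) x)) *
        cnj (a (- (n - k)) (spow \<sigma> (- (n - k)) (spow \<sigma> (- k) x)))", symmetric], rule infsum_cong)
    fix k :: int
    have "- k + - n = - (k + n)" "- (n - (k + n)) = k" "k + - (k + n) = - n" "- n - k = - (k + n)"
      by auto
    then show "cnj (a k (spow \<sigma> (- n) x) * b (- n - k) (spow \<sigma> (- k) (spow \<sigma> (- n) x))) =
        cnj (b (- (k + n)) (spow \<sigma> (- (k + n)) x)) *
        cnj (a (- (n - (k + n))) (spow \<sigma> (- (n - (k + n))) (spow \<sigma> (- (k + n)) x)))"
      by (simp only: complex_cnj_mult mult.commute spow_add[symmetric])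
  qed
qed

lemma cmult_emb_left: "cmult \<sigma> (emb f) l n x = f x * l n x"
proof -
  have "cmult \<sigma> (emb f) l n x = (\<Sum>\<^sub>\<infinity>k\<in>{0::int}. f x * l n x)"
    unfolding cmult_apply by (rule infsum_cong_neutral) (auto simp: emb_apply)
  then show ?thesis by simp
qed

lemma cmult_emb_right: "cmult \<sigma> l (emb f) n x = l n x * f (spow \<sigma> (- n) x)"
proof -
  have "cmult \<sigma> l (emb f) n x = (\<Sum>\<^sub>\<infinity>k\<in>{n}. l n x * f (spow \<sigma> (- n) x))"
    unfolding cmult_apply by (rule infsum_cong_neutral) (auto simp: emb_apply)
  then show ?thesis by simp
qed

lemma cone_cmult: "cmult \<sigma> cone l = l" "cmult \<sigma> l cone = l"
  by (auto simp: cone_def fun_eq_iff cmult_emb_left cmult_emb_right)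

lemma monomial_c00:
  assumes "f \<in> CX"
  shows "(\<lambda>k. if k = n then f else (\<lambda>x. 0)) \<in> (c00 :: 'a cp set)"
proof -
  let ?l = "\<lambda>k. if k = n then f else (\<lambda>x. 0)"
  have "?l \<in> l1"
  proof (rule l1I)
    show "continuous_on UNIV (?l k)" for k using assms by (auto simp: CX_def)
    show "(\<lambda>k. if k = n then supnorm f else 0) summable_on UNIV"
      by (rule finite_nonzero_values_imp_summable_on) auto
    show "norm (?l k x) \<le> (if k = n then supnorm f else 0)" for k x
      using assms by (auto simp: CX_def norm_le_supnorm)
  qed
  then show ?thesis by (auto simp: c00_def intro: finite_subset[of _ "{n}"])
qed

subsection \<open>The commutant of the continuous functions\<close>

text \<open>A compact Hausdorff space is normal; Urysohn's lemma is applied to the closed sets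
  \<open>- U\<close> and \<open>{x}\<close>.\<close>

lemma Urysohn_point:
  assumes "open U" "(x::'a) \<in> U"
  obtains f where "f \<in> CX" "f x = 1" "\<And>y. y \<notin> U \<Longrightarrow> f y = 0"
proof -
  have "compact_space (euclidean :: 'a topology)"
    using compact_UNIV by (simp add: compact_space_def)
  moreover have "Hausdorff_space (euclidean :: 'a topology)"
    unfolding Hausdorff_space_def using t2_space_class.hausdorff by (auto simp: disjnt_def)
  ultimately have "normal_space (euclidean :: 'a topology)"
    by (simp add: compact_Hausdorff_or_regular_imp_normal_space)
  moreover have "closedin euclidean {x}" "closedin euclidean (- U)" "disjnt (- U) {x}"
    using assms by auto
  ultimately obtain f :: "'a \<Rightarrow> real" where f: "continuous_map euclidean euclideanreal f"
    "f ` (- U) \<subseteq> {0}" "f ` {x} \<subseteq> {1}"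
    using Urysohn_lemma_alt by metis
  show thesis
  proof
    show "(\<lambda>x. complex_of_real (f x)) \<in> CX"
      using f(1) by (auto simp: CX_def intro!: continuous_intros)
  qed (use f in auto)
qed

text \<open>Comparing coefficients at degree \<open>k\<close>, commutation means
  \<open>f x = f (spow \<sigma> (- k) x)\<close> for all \<open>f\<close> wherever
  \<open>l k x\<close> is nonzero. Continuous functions separate points, so the open set where
  \<open>l k\<close> is nonzero lies in \<open>Fix \<sigma> k\<close>, hence in its
  interior.\<close>

lemma comm1_iff: "l \<in> comm1 \<sigma> \<longleftrightarrow> l \<in> l1 \<and> (\<forall>k x. l k x \<noteq> 0 \<longrightarrow> x \<in> F k)"
proof safe
  assume l: "l \<in> comm1 \<sigma>"
  then show l1: "l \<in> l1" by (simp add: comm1_def)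
  fix k x assume nz: "l k x \<noteq> 0"
  have "open {y. l k y \<noteq> 0}"
    using l1_continuous[OF l1, of k]
    by (intro open_Collect_neq continuous_intros) auto
  moreover have "{y. l k y \<noteq> 0} \<subseteq> Fix \<sigma> k"
  proof clarify
    fix y assume y: "l k y \<noteq> 0"
    show "y \<in> Fix \<sigma> k"
    proof (rule ccontr)
      assume "y \<notin> Fix \<sigma> k"
      then have ne: "spow \<sigma> (- k) y \<noteq> y" using Fix_minus[of k] by (auto simp: Fix_def)
      obtain f where f: "f \<in> CX" "f y = 1" "\<And>z. z \<notin> - {spow \<sigma> (- k) y} \<Longrightarrow> f z = 0"
        by (rule Urysohn_point[of "- {spow \<sigma> (- k) y}" y]) (use ne in auto)
      have "cmult \<sigma> (emb f) l k y = cmult \<sigma> l (emb f) k y"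
        using l f(1) by (simp add: comm1_def)
      then show False using f y by (simp add: cmult_emb_left cmult_emb_right)
    qed
  qed
  ultimately show "x \<in> F k" using nz interior_maximal by blast
next
  assume l: "l \<in> l1" and F: "\<forall>k x. l k x \<noteq> 0 \<longrightarrow> x \<in> F k"
  have "f x * l k x = l k x * f (spow \<sigma> (- k) x)" for f k x
    using F F_fixed_minus[of x k] by (cases "l k x = 0") auto
  then show "l \<in> comm1 \<sigma>" using l by (auto simp: comm1_def fun_eq_iff cmult_emb_left cmult_emb_right)
qed

lemma comm1_l1: "l \<in> comm1 \<sigma> \<Longrightarrow> l \<in> l1"
  by (simp add: comm1_def)

lemma comm1_F: "l \<in> comm1 \<sigma> \<Longrightarrow> l k x \<noteq> 0 \<Longrightarrow> x \<in> F k"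
  by (simp add: comm1_iff)

lemma comm1_zero: "0 \<in> comm1 \<sigma>"
  by (simp add: comm1_iff l1_zero)

lemma comm1_add: "a \<in> comm1 \<sigma> \<Longrightarrow> b \<in> comm1 \<sigma> \<Longrightarrow> a + b \<in> comm1 \<sigma>"
  by (auto simp: comm1_iff l1_add) (metis add_0)

lemma comm1_cscale: "a \<in> comm1 \<sigma> \<Longrightarrow> cscale c a \<in> comm1 \<sigma>"
  using l1_cscale by (auto simp: comm1_iff) (auto simp: cscale_def)

lemma comm1_diff: "a \<in> comm1 \<sigma> \<Longrightarrow> b \<in> comm1 \<sigma> \<Longrightarrow> a - b \<in> comm1 \<sigma>"
  using comm1_add[of a "- b"] comm1_cscale[of b "-1"] by (simp add: uminus_eq_cscale[symmetric])

text \<open>A nonzero coefficient of degree \<open>n\<close> has a nonzero term; its degrees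
  \<open>k\<close> and \<open>n - k\<close> belong to the subgroup attached to \<open>x\<close>, and
  so does their sum.\<close>

lemma comm1_cmult:
  assumes "a \<in> comm1 \<sigma>" "b \<in> comm1 \<sigma>"
  shows "cmult \<sigma> a b \<in> comm1 \<sigma>"
  unfolding comm1_iff
proof (intro conjI allI impI)
  show "cmult \<sigma> a b \<in> l1" using assms by (simp add: cmult_l1 comm1_l1)
  fix n x assume "cmult \<sigma> a b n x \<noteq> 0"
  then obtain k where "a k x \<noteq> 0" "b (n - k) (spow \<sigma> (- k) x) \<noteq> 0"
    unfolding cmult_apply by (metis (mono_tags, lifting) infsum_0 mult_eq_0_iff)
  then have "x \<in> F k" "x \<in> F (n - k)" using assms comm1_F F_spow by blast+
  then show "x \<in> F n" using F_add by fastforce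
qed

lemma emb_comm1: "f \<in> CX \<Longrightarrow> emb f \<in> comm1 \<sigma>"
  using monomial_c00[of f 0] by (auto simp: comm1_iff emb_def c00_def)

lemma cone_comm1: "cone \<in> comm1 \<sigma>"
  unfolding cone_def by (rule emb_comm1) (simp add: CX_def)

lemma cstar_cone: "cstar \<sigma> cone = cone"
  by (auto simp: fun_eq_iff cstar_apply cone_def emb_def)

text \<open>The equation says that the square of \<open>1 - y\<close> is \<open>1 - h\<close>. Its
  solution is the fixed point of a contraction that preserves the self-adjoint elements of norm at
  most 1/4 in the commutant.\<close>

lemma comm1_sqrt:
  assumes h: "h \<in> comm1 \<sigma>" "cstar \<sigma> h = h" "l1norm h \<le> 1/4"
  obtains y where "y \<in> comm1 \<sigma>" "cstar \<sigma> y = y" "cscale 2 y = h + cmult \<sigma> y y"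
proof -
  define Y where "Y = rec_nat 0 (\<lambda>_ y. cscale (1/2) (h + cmult \<sigma> y y))"
  have Y0: "Y 0 = 0" and YS: "Y (Suc n) = cscale (1/2) (h + cmult \<sigma> (Y n) (Y n))" for n
    by (simp_all add: Y_def)
  have Y: "Y n \<in> comm1 \<sigma> \<and> cstar \<sigma> (Y n) = Y n \<and> l1norm (Y n) \<le> 1/4" for n
  proof (induction n)
    case 0
    have "l1norm (0 :: 'a cp) = 0" by (simp add: l1norm_def supnorm_def)
    moreover have "cstar \<sigma> 0 = 0" by (auto simp: fun_eq_iff cstar_apply)
    ultimately show ?case unfolding Y0 using comm1_zero by (simp del: zero_fun_apply)
  next
    case (Suc n)
    have c: "h + cmult \<sigma> (Y n) (Y n) \<in> comm1 \<sigma>"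
      using Suc h by (auto intro!: comm1_add comm1_cmult)
    have "l1norm (cmult \<sigma> (Y n) (Y n)) \<le> l1norm (Y n) * l1norm (Y n)"
      using Suc by (intro cmult_l1 comm1_l1) auto
    also have "\<dots> \<le> 1/4 * (1/4)"
      using Suc l1norm_nonneg[OF comm1_l1] by (intro mult_mono) auto
    \<comment> \<open>Half of 1/4 + 1/16 is below 1/4, so the iteration stays in the ball.\<close>
    finally have "l1norm (h + cmult \<sigma> (Y n) (Y n)) \<le> 1/4 + 1/16"
      using l1_add(2)[of h "cmult \<sigma> (Y n) (Y n)"] Suc h by (simp add: comm1_l1 cmult_l1)
    then have "l1norm (Y (Suc n)) \<le> 1/4"
      using l1_cscale(2)[OF comm1_l1[OF c], of "1/2"] by (simp add: YS norm_divide)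
    then show ?case
      using c Suc h(2) by (simp add: YS comm1_cscale cstar_cscale cstar_add cstar_cmult)
  qed
  have Yl: "Y n \<in> l1" for n using Y comm1_l1 by blast
  define d where "d n = Y (Suc n) - Y n" for n
  have dc: "d n \<in> comm1 \<sigma>" for n using Y by (simp add: d_def comm1_diff)
  then have dl: "d n \<in> l1" for n by (rule comm1_l1)
  have dstar: "cstar \<sigma> (d n) = d n" for n using Y by (simp add: d_def cstar_diff)
  have dn: "l1norm (d n) \<le> (1/4) ^ n" for n
  proof (induction n)
    case 0
    have "cmult \<sigma> 0 0 = (0 :: 'a cp)" by (auto simp: fun_eq_iff cmult_apply)
    then have "d 0 = cscale (1/2) h" by (simp add: d_def Y0 YS)
    then show ?case using l1_cscale(2)[OF comm1_l1[OF h(1)], of "1/2"] h(3) by (simp add: norm_divide)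
  next
    case (Suc n)
    have "d (Suc n) = cscale (1/2) (cmult \<sigma> (Y (Suc n)) (Y (Suc n)) - cmult \<sigma> (Y n) (Y n))"
      unfolding d_def by (subst (1 2) YS) (auto simp: fun_eq_iff cscale_def algebra_simps)
    \<comment> \<open>The noncommutative difference of squares. Both iterates have norm at most 1/4
      and the outer factor is 1/2, which gives the contraction factor 1/4.\<close>
    also have "cmult \<sigma> (Y (Suc n)) (Y (Suc n)) - cmult \<sigma> (Y n) (Y n)
        = cmult \<sigma> (Y (Suc n)) (d n) + cmult \<sigma> (d n) (Y n)"
      using Yl by (simp add: d_def cmult_diff_left cmult_diff_right)
    finally have eq: "d (Suc n) = cscale (1/2) (cmult \<sigma> (Y (Suc n)) (d n) + cmult \<sigma> (d n) (Y n))" .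
    have "l1norm (cmult \<sigma> (Y (Suc n)) (d n)) \<le> l1norm (Y (Suc n)) * l1norm (d n)"
      by (rule cmult_l1[OF Yl dl])
    also have "\<dots> \<le> 1/4 * l1norm (d n)"
      using Y l1norm_nonneg[OF dl] by (intro mult_right_mono) auto
    finally have 1: "l1norm (cmult \<sigma> (Y (Suc n)) (d n)) \<le> 1/4 * l1norm (d n)" .
    have "l1norm (cmult \<sigma> (d n) (Y n)) \<le> l1norm (d n) * l1norm (Y n)"
      by (rule cmult_l1[OF dl Yl])
    also have "\<dots> \<le> l1norm (d n) * (1/4)"
      using Y l1norm_nonneg[OF dl] by (intro mult_left_mono) auto
    finally have 2: "l1norm (cmult \<sigma> (d n) (Y n)) \<le> 1/4 * l1norm (d n)" by simp
    have "l1norm (d (Suc n)) \<le> 1/2 * l1norm (cmult \<sigma> (Y (Suc n)) (d n) + cmult \<sigma> (d n) (Y n))"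
      unfolding eq
      using l1_cscale(2)[OF l1_add(1)[OF cmult_l1(1)[OF Yl[of "Suc n"] dl[of n]] cmult_l1(1)[OF dl[of n] Yl[of n]]], of "1/2"]
      by (simp add: norm_divide)
    also have "\<dots> \<le> 1/2 * (1/2 * l1norm (d n))"
      using l1_add(2)[OF cmult_l1(1)[OF Yl[of "Suc n"] dl[of n]] cmult_l1(1)[OF dl[of n] Yl[of n]]] 1 2 by linarith
    finally show ?case using Suc by simp
  qed
  have sg: "(\<lambda>n. (1/4 :: real) ^ n) summable_on A" for A
    by (rule summable_on_subset_banach[OF summable_nonneg_imp_summable_on]) auto
  define C where "C = (\<Sum>\<^sub>\<infinity>n. (1/4 :: real) ^ n)"
  define y where "y = (\<lambda>k x. \<Sum>\<^sub>\<infinity>n. d n k x)"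
  have yl: "y \<in> l1" unfolding y_def by (rule l1_infsum[OF dl sg dn])
  have ds: "(\<lambda>n. d n k x) summable_on A" for k x A
    by (rule l1_infsum(3)[OF dl sg dn])
  \<comment> \<open>The increments telescope from \<open>Y 0 = 0\<close>, so \<open>y - Y N\<close>
    is the tail of the series.\<close>
  have yY: "l1norm (y - Y N) \<le> (1/4) ^ N * C" for N
  proof -
    have "y - Y N = (\<lambda>k x. \<Sum>\<^sub>\<infinity>n\<in>{N..}. d n k x)"
    proof (intro ext)
      fix k x
      have "y k x = (\<Sum>\<^sub>\<infinity>n\<in>{..<N} \<union> {N..}. d n k x)"
        unfolding y_def by (rule infsum_cong_neutral) auto
      also have "\<dots> = (\<Sum>n<N. d n k x) + (\<Sum>\<^sub>\<infinity>n\<in>{N..}. d n k x)"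
        by (subst infsum_Un_disjoint[OF ds ds]) auto
      also have "(\<Sum>n<N. d n k x) = Y N k x"
        using sum_lessThan_telescope[of "\<lambda>n. Y n k x" N] by (simp add: d_def Y0)
      finally show "(y - Y N) k x = (\<Sum>\<^sub>\<infinity>n\<in>{N..}. d n k x)" by simp
    qed
    then have "l1norm (y - Y N) \<le> (\<Sum>\<^sub>\<infinity>n\<in>{N..}. (1/4) ^ n)"
      using l1_infsum(2)[where A = "{N..}", OF dl sg dn] by simp
    also have "\<dots> = (\<Sum>\<^sub>\<infinity>m. (1/4) ^ (m + N))"
    proof -
      have "bij_betw (\<lambda>m. m + N) UNIV {N..}"
        by (rule bij_betw_byWitness[where f' = "\<lambda>n. n - N"]) auto
      from infsum_reindex_bij_betw[OF this, of "\<lambda>n. (1/4 :: real) ^ n"] show ?thesis by simp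
    qed
    also have "\<dots> = (1/4) ^ N * C"
      by (simp add: power_add C_def infsum_cmult_left')
    finally show ?thesis .
  qed
  have yc: "y \<in> comm1 \<sigma>"
    unfolding comm1_iff
  proof (intro conjI allI impI yl)
    fix k x assume "y k x \<noteq> 0"
    then obtain n where "d n k x \<noteq> 0" unfolding y_def by (metis (mono_tags, lifting) infsum_0)
    then show "x \<in> F k" using dc comm1_F by blast
  qed
  have ystar: "cstar \<sigma> y = y"
  proof (intro ext)
    fix k x
    have "cstar \<sigma> y k x = (\<Sum>\<^sub>\<infinity>n. cstar \<sigma> (d n) k x)"
      unfolding cstar_apply y_def infsum_cnj[symmetric] ..
    then show "cstar \<sigma> y k x = y k x" by (simp add: dstar y_def)
  qed
  \<comment> \<open>The defect of \<open>y\<close> in the equation. It vanishes because its norm is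
    at most \<open>(1/4) ^ N * K\<close> for every \<open>N\<close>, which replaces a continuity
    argument for the product.\<close>
  define z where "z = cscale 2 y - (h + cmult \<sigma> y y)"
  have hl: "h \<in> l1" using h comm1_l1 by blast
  have zl: "z \<in> l1" unfolding z_def by (intro l1_diff l1_add l1_cscale cmult_l1 yl hl)
  \<comment> \<open>The three terms bound \<open>cscale 2 ?s\<close>,
    \<open>cmult \<sigma> ?r y\<close> and \<open>cmult \<sigma> (Y N) ?r\<close> below; in the last
    one \<open>l1norm (Y N)\<close> is estimated by 1.\<close>
  define K where "K = 2 * C + C * l1norm y + C"
  have C0: "C \<ge> 0" unfolding C_def by (rule infsum_nonneg) auto
  have zb: "l1norm z \<le> (1/4) ^ N * K" for N
  proof -
    let ?r = "y - Y N" and ?s = "y - Y (Suc N)"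
    have rl: "?r \<in> l1" and sl: "?s \<in> l1" using yl Yl by (auto intro: l1_diff)
    have "cscale 2 (Y (Suc N)) = h + cmult \<sigma> (Y N) (Y N)"
      by (auto simp: YS fun_eq_iff cscale_def)
    then have "z = cscale 2 ?s - (cmult \<sigma> y y - cmult \<sigma> (Y N) (Y N))"
      by (auto simp: z_def fun_eq_iff cscale_def algebra_simps)
    also have "cmult \<sigma> y y - cmult \<sigma> (Y N) (Y N) = cmult \<sigma> ?r y + cmult \<sigma> (Y N) ?r"
      using Yl yl by (simp add: cmult_diff_left cmult_diff_right)
    finally have zeq: "z = cscale 2 ?s - (cmult \<sigma> ?r y + cmult \<sigma> (Y N) ?r)" .
    have "l1norm z \<le> l1norm (cscale 2 ?s) + (l1norm (cmult \<sigma> ?r y) + l1norm (cmult \<sigma> (Y N) ?r))"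
      unfolding zeq using l1_diff(2)[OF l1_cscale(1)[OF sl, of 2] l1_add(1)[OF cmult_l1(1)[OF rl yl] cmult_l1(1)[OF Yl[of N] rl]]]
        l1_add(2)[OF cmult_l1(1)[OF rl yl] cmult_l1(1)[OF Yl[of N] rl]] by linarith
    also have "l1norm (cscale 2 ?s) \<le> 2 * ((1/4) ^ N * C)"
    proof -
      have "(1/4 :: real) ^ Suc N * C \<le> (1/4) ^ N * C"
        using C0 by (intro mult_right_mono) auto
      moreover have "l1norm (cscale 2 ?s) \<le> 2 * l1norm ?s"
        using l1_cscale(2)[OF sl, of 2] by simp
      ultimately show ?thesis using yY[of "Suc N"] by linarith
    qed
    also have "l1norm (cmult \<sigma> ?r y) \<le> (1/4) ^ N * C * l1norm y"
      using cmult_l1(2)[OF rl yl] mult_right_mono[OF yY[of N] l1norm_nonneg[OF yl]] by linarith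
    also have "l1norm (cmult \<sigma> (Y N) ?r) \<le> (1/4) ^ N * C"
    proof -
      have "l1norm (Y N) * l1norm ?r \<le> 1 * ((1/4) ^ N * C)"
        using Y[of N] yY[of N] l1norm_nonneg[OF rl] by (intro mult_mono) auto
      then show ?thesis using cmult_l1(2)[OF Yl[of N] rl] by linarith
    qed
    finally show ?thesis by (simp add: K_def algebra_simps)
  qed
  have "l1norm z \<le> 0"
  proof (rule LIMSEQ_le_const)
    show "(\<lambda>N. (1/4) ^ N * K) \<longlonglongrightarrow> 0"
      by (intro tendsto_mult_left_zero LIMSEQ_realpow_zero) auto
  qed (use zb in auto)
  then have "z = 0" using zl l1norm_zero_imp by blast
  then have "cscale 2 y = h + cmult \<sigma> y y" by (simp add: z_def)
  with yc ystar show thesis using that by blast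
qed

subsection \<open>States of the commutant\<close>

lemma state_add: "state \<sigma> \<phi> \<Longrightarrow> a \<in> comm1 \<sigma> \<Longrightarrow> b \<in> comm1 \<sigma> \<Longrightarrow> \<phi> (a + b) = \<phi> a + \<phi> b"
  by (simp add: state_def cadd_eq_plus)

lemma state_cscale: "state \<sigma> \<phi> \<Longrightarrow> a \<in> comm1 \<sigma> \<Longrightarrow> \<phi> (cscale c a) = c * \<phi> a"
  by (simp add: state_def)

lemma state_square: "state \<sigma> \<phi> \<Longrightarrow> a \<in> comm1 \<sigma> \<Longrightarrow>
    Im (\<phi> (cmult \<sigma> (cstar \<sigma> a) a)) = 0 \<and> Re (\<phi> (cmult \<sigma> (cstar \<sigma> a) a)) \<ge> 0"
  by (simp add: state_def)

lemma state_diff: "state \<sigma> \<phi> \<Longrightarrow> a \<in> comm1 \<sigma> \<Longrightarrow> b \<in> comm1 \<sigma> \<Longrightarrow> \<phi> (a - b) = \<phi> a - \<phi> b"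
  using state_add[of \<phi> "a - b" b] comm1_diff[of a b] by simp

lemma state_zero: "state \<sigma> \<phi> \<Longrightarrow> \<phi> 0 = 0"
  using state_add[of \<phi> 0 0] comm1_zero by simp

lemma state_selfadjoint_le_1:
  assumes \<phi>: "state \<sigma> \<phi>" and h: "h \<in> comm1 \<sigma>" "cstar \<sigma> h = h" "l1norm h \<le> 1/4"
  shows "Im (\<phi> h) = 0" "Re (\<phi> h) \<le> 1"
proof -
  obtain y where y: "y \<in> comm1 \<sigma>" "cstar \<sigma> y = y" "cscale 2 y = h + cmult \<sigma> y y"
    using comm1_sqrt[OF h] by blast
  note l = comm1_l1[OF y(1)] comm1_l1[OF cone_comm1]
  \<comment> \<open>Since \<open>y\<close> is self-adjoint, this exhibits \<open>cone - h\<close> as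
    an element of the form \<open>a* a\<close>, on which the state is nonnegative.\<close>
  have "cmult \<sigma> (cstar \<sigma> (cone - y)) (cone - y) = cone - cscale 2 y + cmult \<sigma> y y"
    using l by (simp add: y(2) cstar_diff cstar_cone cmult_diff_left cmult_diff_right l1_diff cone_cmult)
      (auto simp: fun_eq_iff cscale_def)
  also have "\<dots> = cone - h" by (simp add: y(3))
  finally have "Im (\<phi> (cone - h)) = 0 \<and> Re (\<phi> (cone - h)) \<ge> 0"
    using state_square[OF \<phi> comm1_diff[OF cone_comm1 y(1)]] by simp
  moreover have "\<phi> (cone - h) = 1 - \<phi> h"
    using state_diff[OF \<phi> cone_comm1 h(1)] \<phi> by (simp add: state_def)
  ultimately show "Im (\<phi> h) = 0" "Re (\<phi> h) \<le> 1" by auto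
qed

lemma state_selfadjoint_ge:
  assumes \<phi>: "state \<sigma> \<phi>" and h: "h \<in> comm1 \<sigma>" "cstar \<sigma> h = h" "l1norm h \<le> \<epsilon> / 4" and \<epsilon>: "\<epsilon> > 0"
  shows "Im (\<phi> h) = 0" "Re (\<phi> h) \<ge> - \<epsilon>"
proof -
  \<comment> \<open>Scaling by \<open>1 / \<epsilon>\<close> brings the norm down to 1/4; the sign
    turns the upper bound 1 into a lower bound for \<open>h\<close>.\<close>
  let ?c = "complex_of_real (- (1 / \<epsilon>))"
  let ?g = "cscale ?c h"
  have "l1norm ?g \<le> norm ?c * l1norm h" by (rule l1_cscale[OF comm1_l1[OF h(1)]])
  also have "\<dots> = 1/\<epsilon> * l1norm h" using \<epsilon> by (simp add: norm_divide del: of_real_minus of_real_divide)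
  also have "\<dots> \<le> 1/\<epsilon> * (\<epsilon>/4)" using h(3) \<epsilon> by (intro mult_left_mono) auto
  finally have g: "l1norm ?g \<le> 1/4" using \<epsilon> by simp
  have gs: "cstar \<sigma> ?g = ?g" by (simp add: cstar_cscale h(2))
  have "\<phi> ?g = ?c * \<phi> h" using state_cscale[OF \<phi> h(1)] .
  then have "Im (\<phi> ?g) = - (1/\<epsilon>) * Im (\<phi> h)" "Re (\<phi> ?g) = - (1/\<epsilon>) * Re (\<phi> h)"
    by (simp_all del: of_real_minus of_real_divide)
  with state_selfadjoint_le_1[OF \<phi> comm1_cscale[OF h(1)] gs g] have "Im (\<phi> h) = 0" "- (1/\<epsilon>) * Re (\<phi> h) \<le> 1"
    using \<epsilon> by simp_all
  then show "Im (\<phi> h) = 0" "Re (\<phi> h) \<ge> - \<epsilon>"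
    using \<epsilon> by (simp_all add: field_simps)
qed

end

subsection \<open>The projection onto the commutant\<close>

text \<open>Pasting lemma: \<open>U\<close> and its complement are both closed, cover the space and
  do not overlap.\<close>

lemma continuous_on_restrict_clopen:
  fixes f :: "'a::topological_space \<Rightarrow> 'b::{topological_space,zero}"
  assumes "open U" "closed U" "continuous_on UNIV f"
  shows "continuous_on UNIV (\<lambda>x. if x \<in> U then f x else 0)"
proof -
  have "continuous_on (U \<union> - U) (\<lambda>x. if x \<in> U then f x else 0)"
    by (rule continuous_on_cases) (use assms in \<open>auto intro: continuous_on_subset\<close>)
  then show ?thesis by simp
qed

context compact_dynamical_system
begin

text \<open>Defined on arbitrary coefficient families, so that its algebraic identities hold before
  any \<open>F k\<close> is known to be closed; closedness enters only to keep coefficients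
  continuous.\<close>

definition E :: "'a cp \<Rightarrow> 'a cp" where
  "E l = (\<lambda>k x. if x \<in> F k then l k x else 0)"

lemma E_add: "E (a + b) = E a + E b"
  by (auto simp: E_def fun_eq_iff)

lemma E_diff: "E (a - b) = E a - E b"
  by (auto simp: E_def fun_eq_iff)

lemma E_cscale: "E (cscale c a) = cscale c (E a)"
  by (auto simp: E_def fun_eq_iff cscale_def)

lemma E_zero: "E 0 = 0"
  by (auto simp: E_def fun_eq_iff)

lemma E_idem: "E (E a) = E a"
  by (auto simp: E_def fun_eq_iff)

lemma E_comm1_id: "a \<in> comm1 \<sigma> \<Longrightarrow> E a = a"
  using comm1_F[of a] by (auto simp: E_def fun_eq_iff)

lemma E_cstar: "E (cstar \<sigma> a) = cstar \<sigma> (E a)"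
  by (auto simp: E_def fun_eq_iff cstar_apply)

text \<open>If \<open>a k x\<close> is nonzero then \<open>x \<in> F k\<close>, so
  \<open>x \<in> F n\<close> and \<open>x \<in> F (n - k)\<close> are equivalent. Cutting off before
  or after multiplication thus keeps the same terms, because the \<open>F\<close> sets are also
  invariant under \<open>spow\<close>.\<close>

lemma E_cmult_left:
  assumes "a \<in> comm1 \<sigma>"
  shows "E (cmult \<sigma> a l) = cmult \<sigma> a (E l)"
proof (intro ext)
  fix n x
  have "(if x \<in> F n then a k x * l (n - k) (spow \<sigma> (- k) x) else 0)
      = a k x * E l (n - k) (spow \<sigma> (- k) x)" for k
    using comm1_F[OF assms, of k x] F_diff_iff[of x k n] by (cases "a k x = 0") (auto simp: E_def)
  then have "cmult \<sigma> a (E l) n x = (\<Sum>\<^sub>\<infinity>k. if x \<in> F n then a k x * l (n - k) (spow \<sigma> (- k) x) else 0)"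
    by (simp add: cmult_apply)
  then show "E (cmult \<sigma> a l) n x = cmult \<sigma> a (E l) n x"
    by (auto simp: E_def[of "cmult \<sigma> a l"] cmult_apply)
qed

lemma E_cmult_right:
  assumes "b \<in> comm1 \<sigma>"
  shows "E (cmult \<sigma> l b) = cmult \<sigma> (E l) b"
proof (intro ext)
  fix n x
  have "(if x \<in> F n then l k x * b (n - k) (spow \<sigma> (- k) x) else 0)
      = E l k x * b (n - k) (spow \<sigma> (- k) x)" for k
    using comm1_F[OF assms, of "n - k" "spow \<sigma> (- k) x"] F_diff_iff[of x "n - k" n]
    by (cases "b (n - k) (spow \<sigma> (- k) x) = 0") (auto simp: E_def)
  then have "cmult \<sigma> (E l) b n x = (\<Sum>\<^sub>\<infinity>k. if x \<in> F n then l k x * b (n - k) (spow \<sigma> (- k) x) else 0)"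
    by (simp add: cmult_apply)
  then show "E (cmult \<sigma> l b) n x = cmult \<sigma> (E l) b n x"
    by (auto simp: E_def[of "cmult \<sigma> l b"] cmult_apply)
qed

text \<open>Replacing the summation index by its negative makes each term read both factors at the
  same point \<open>spow \<sigma> i x\<close>.\<close>

lemma cstar_cmult_apply:
  "cmult \<sigma> (cstar \<sigma> a) b n x = (\<Sum>\<^sub>\<infinity>i. cnj (a i (spow \<sigma> i x)) * b (n + i) (spow \<sigma> i x))"
proof -
  have "bij_betw (\<lambda>i::int. - i) UNIV UNIV"
    by (rule bij_betw_byWitness[where f' = "\<lambda>i. - i"]) auto
  from infsum_reindex_bij_betw[OF this, of "\<lambda>k. cstar \<sigma> a k x * b (n - k) (spow \<sigma> (- k) x)"]
  show ?thesis by (simp add: cmult_apply cstar_apply)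
qed

text \<open>The coefficient at degree 0 is the sum of the squared moduli of
  \<open>l i (spow \<sigma> i x)\<close> over \<open>i\<close>, so its vanishing kills every
  term.\<close>

lemma cstar_cmult_self_0:
  assumes "l \<in> l1"
  shows "Im (cmult \<sigma> (cstar \<sigma> l) l 0 x) = 0" "Re (cmult \<sigma> (cstar \<sigma> l) l 0 x) \<ge> 0"
    "cmult \<sigma> (cstar \<sigma> l) l 0 x = 0 \<Longrightarrow> l i (spow \<sigma> i x) = 0"
proof -
  let ?t = "\<lambda>i. (norm (l i (spow \<sigma> i x)))\<^sup>2"
  have sq: "cnj z * z = of_real ((norm z)\<^sup>2)" for z :: complex
    by (metis complex_norm_square mult.commute)
  have eq: "cmult \<sigma> (cstar \<sigma> l) l 0 x = (\<Sum>\<^sub>\<infinity>i. of_real (?t i))"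
    unfolding cstar_cmult_apply by (simp add: sq)
  have "bij_betw (\<lambda>i::int. - i) UNIV UNIV"
    by (rule bij_betw_byWitness[where f' = "\<lambda>i. - i"]) auto
  \<comment> \<open>Convergence must be secured first: a divergent sum would default to zero and
    give no information on the terms.\<close>
  from summable_on_reindex_bij_betw[OF this, of "\<lambda>k. cstar \<sigma> l k x * l (0 - k) (spow \<sigma> (- k) x)"]
  have "(\<lambda>i. complex_of_real (?t i)) summable_on UNIV"
    using cmult_l1(3)[OF cstar_l1(1)[OF assms] assms, of x 0] by (simp add: cstar_apply sq)
  then have s: "?t summable_on UNIV"
    using summable_on_Re[of "\<lambda>i. complex_of_real (?t i)" UNIV] by (simp only: Re_complex_of_real)
  then have eq': "cmult \<sigma> (cstar \<sigma> l) l 0 x = of_real (\<Sum>\<^sub>\<infinity>i. ?t i)"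
    unfolding eq by (intro infsumI has_sum_of_real has_sum_infsum)
  have "(\<Sum>\<^sub>\<infinity>i. ?t i) \<ge> 0" by (rule infsum_nonneg) auto
  with eq' show "Im (cmult \<sigma> (cstar \<sigma> l) l 0 x) = 0" "Re (cmult \<sigma> (cstar \<sigma> l) l 0 x) \<ge> 0"
    by (metis Im_complex_of_real, metis Re_complex_of_real)
  assume "cmult \<sigma> (cstar \<sigma> l) l 0 x = 0"
  then have "(\<Sum>\<^sub>\<infinity>i. ?t i) = 0" unfolding eq' of_real_eq_0_iff .
  then have "?t i = 0"
    by (intro nonneg_infsum_le_0D[OF _ s]) auto
  then show "l i (spow \<sigma> i x) = 0" by simp
qed

lemma poscone_l1: "p \<in> poscone \<sigma> \<Longrightarrow> p \<in> l1"
proof (induction rule: poscone.induct)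
  case zero
  show ?case unfolding zero_cp by (rule l1_zero)
next
  case (step l p)
  then show ?case unfolding cadd_eq_plus by (intro l1_add cmult_l1 cstar_l1)
qed

text \<open>Both claims go through one induction: nonnegativity is what makes a vanishing sum of two
  coefficients force each of them to vanish. Since \<open>E\<close> fixes the coefficient at degree
  0, faithfulness follows.\<close>

lemma poscone_0:
  assumes "p \<in> poscone \<sigma>"
  shows "(\<forall>x. Im (p 0 x) = 0 \<and> Re (p 0 x) \<ge> 0) \<and> ((\<forall>x. p 0 x = 0) \<longrightarrow> p = 0)"
  using assms
proof (induction rule: poscone.induct)
  case zero
  then show ?case by (simp add: zero_cp)
next
  case (step l p)
  note q = cstar_cmult_self_0[OF step(1)]
  have "cadd (cmult \<sigma> (cstar \<sigma> l) l) p = 0" if z: "\<And>x. cadd (cmult \<sigma> (cstar \<sigma> l) l) p 0 x = 0"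
  proof -
    have 0: "cmult \<sigma> (cstar \<sigma> l) l 0 x = 0 \<and> p 0 x = 0" for x
    proof -
      have "cmult \<sigma> (cstar \<sigma> l) l 0 x + p 0 x = 0"
        using z[of x] by (simp only: cadd_def)
      then have "Re (cmult \<sigma> (cstar \<sigma> l) l 0 x) + Re (p 0 x) = 0"
        by (metis plus_complex.sel(1) zero_complex.sel(1))
      moreover have p: "Im (p 0 x) = 0" "Re (p 0 x) \<ge> 0" using step.IH by blast+
      ultimately have "Re (cmult \<sigma> (cstar \<sigma> l) l 0 x) = 0" "Re (p 0 x) = 0"
        using q(2)[of x] by linarith+
      with p(1) q(1)[of x] show ?thesis by (simp only: complex_eq_iff zero_complex.sel)
    qed
    have "l = 0"
    proof (intro ext)
      fix i x
      show "l i x = 0 i x" using q(3)[of "spow \<sigma> (- i) x" i] 0 by simp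
    qed
    then have "cmult \<sigma> (cstar \<sigma> l) l = 0" by (auto simp: fun_eq_iff cmult_apply)
    moreover have "p = 0" using 0 step.IH by blast
    ultimately show ?thesis unfolding cadd_eq_plus by (simp only: add_0)
  qed
  moreover have "Im (cadd (cmult \<sigma> (cstar \<sigma> l) l) p 0 x) = 0 \<and> Re (cadd (cmult \<sigma> (cstar \<sigma> l) l) p 0 x) \<ge> 0" for x
    using q(1,2)[of x] step.IH by (simp add: cadd_def)
  ultimately show ?case by blast
qed

text \<open>The relation \<open>x \<in> F (i - j)\<close> depends on \<open>x\<close>, so its classes cannot be enumerated globally.
  Summing over all \<open>j \<in> S\<close> instead counts each class as often as it has members; the weights \<open>w j\<close>
  in the proof compensate for this, and they are continuous because the sets \<open>F k\<close> are clopen.\<close>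
lemma E_square_eq_sum_squares:
  assumes closed_F: "\<And>k. closed (F k)" and S: "finite S" and l: "l \<in> l1" and supp: "\<And>k x. k \<notin> S \<Longrightarrow> l k x = 0"
  obtains c where "\<And>j. j \<in> S \<Longrightarrow> c j \<in> comm1 \<sigma>"
    "E (cmult \<sigma> (cstar \<sigma> l) l) = (\<Sum>j\<in>S. cmult \<sigma> (cstar \<sigma> (c j)) (c j))"
proof
  \<comment> \<open>\<open>N j x\<close> is the size of the class of \<open>j\<close> at
    \<open>x\<close>; the squares of the weights \<open>w j x\<close> therefore add up to 1 over
    each class.\<close>
  define N where "N j x = card {i \<in> S. x \<in> F (i - j)}" for j x
  define w where "w j x = 1 / sqrt (real (N j x))" for j x
  \<comment> \<open>This is \<open>w j\<close> times \<open>E\<close> of the product of \<delta> to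
    the power \<open>- j\<close> with \<open>l\<close>: the shift moves degree \<open>j\<close> to
    0, and \<open>E\<close> keeps the class of \<open>j\<close>.\<close>
  define c where "c j m x = complex_of_real (w j x) * (if x \<in> F m then l (j + m) (spow \<sigma> j x) else 0)"
    for j m x
  have N1: "N j x \<ge> 1" if "j \<in> S" for j x
  proof -
    have "j \<in> {i \<in> S. x \<in> F (i - j)}" using that by simp
    then show ?thesis unfolding N_def using S
      by (intro Suc_leI[of 0, folded One_nat_def]) (auto simp: card_gt_0_iff)
  qed
  have Nc: "continuous_on UNIV (\<lambda>x. real (N j x))" for j
  proof -
    \<comment> \<open>A finite sum of indicators of clopen sets is continuous.\<close>
    have "real (N j x) = (\<Sum>i\<in>S. if x \<in> F (i - j) then 1 else 0)" for x
      using S by (simp add: N_def sum.If_cases Collect_conj_eq)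
    then show ?thesis
      using closed_F by (auto intro!: continuous_on_sum continuous_on_restrict_clopen)
  qed
  have wc: "continuous_on UNIV (w j)" if "j \<in> S" for j
    unfolding w_def[abs_def] using N1[OF that] Nc[of j]
    by (intro continuous_on_divide continuous_on_const continuous_on_real_sqrt) (auto simp: Suc_le_eq)
  have wn: "norm (complex_of_real (w j x)) \<le> 1" if "j \<in> S" for j x
    using N1[OF that, of x] by (simp add: w_def norm_divide)
  have w2: "(complex_of_real (w j x))\<^sup>2 = 1 / of_nat (N j x)" for j x
    by (simp add: w_def power_divide flip: of_real_power)
  show cc: "c j \<in> comm1 \<sigma>" if j: "j \<in> S" for j
    unfolding comm1_iff
  proof (intro conjI allI impI)
    show "c j \<in> l1"
    proof (rule l1I)
      show "continuous_on UNIV (c j k)" for k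
        unfolding c_def[abs_def] using closed_F wc[OF j] l
        by (intro continuous_on_mult continuous_on_of_real continuous_on_restrict_clopen
            continuous_on_comp_spow l1_continuous) auto
      have "bij_betw (\<lambda>m. j + m) UNIV UNIV"
        by (rule bij_betw_byWitness[where f' = "\<lambda>m. m - j"]) auto
      from summable_on_reindex_bij_betw[OF this, of "\<lambda>k. supnorm (l k)"]
      show "(\<lambda>m. supnorm (l (j + m))) summable_on UNIV" using l1_summable[OF l] by simp
      show "norm (c j m x) \<le> supnorm (l (j + m))" for m x
      proof -
        have "norm (c j m x) \<le> 1 * norm (l (j + m) (spow \<sigma> j x))"
          unfolding c_def norm_mult using wn[OF j, of x] by (intro mult_mono) auto
        then show ?thesis using l1_norm_le[OF l, of "j + m" "spow \<sigma> j x"] by simp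
      qed
    qed
  qed (auto simp: c_def split: if_splits)
  show "E (cmult \<sigma> (cstar \<sigma> l) l) = (\<Sum>j\<in>S. cmult \<sigma> (cstar \<sigma> (c j)) (c j))"
  proof (intro ext)
    fix n x
    define T where "T i = cnj (l i (spow \<sigma> i x)) * l (n + i) (spow \<sigma> i x)" for i
    have ET: "E (cmult \<sigma> (cstar \<sigma> l) l) n x = (if x \<in> F n then (\<Sum>i\<in>S. T i) else 0)"
    proof -
      have "cmult \<sigma> (cstar \<sigma> l) l n x = infsum T S"
        unfolding cstar_cmult_apply by (rule infsum_cong_neutral) (auto simp: T_def supp)
      then show ?thesis using S by (simp add: E_def)
    qed
    have cT: "cmult \<sigma> (cstar \<sigma> (c j)) (c j) n x
        = (\<Sum>i\<in>S. if x \<in> F n \<and> x \<in> F (i - j) then T i / of_nat (N j x) else 0)" (is "_ = sum ?g S")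
      if j: "j \<in> S" for j
    proof -
      have bij: "bij_betw (\<lambda>i. i - j) UNIV UNIV"
        by (rule bij_betw_byWitness[where f' = "\<lambda>m. m + j"]) auto
      \<comment> \<open>With the index shifted to \<open>i - j\<close>, a surviving term has
        \<open>spow \<sigma> (i - j) x = x\<close>. Hence both weights are taken at
        \<open>x\<close>, and \<open>spow \<sigma> j x = spow \<sigma> i x\<close> recovers
        \<open>T i\<close>.\<close>
      have *: "cnj (c j (i - j) (spow \<sigma> (i - j) x)) * c j (n + (i - j)) (spow \<sigma> (i - j) x) =
         (if x \<in> F n \<and> x \<in> F (i - j) then T i / of_nat (N j x) else 0)" for i
      proof (cases "x \<in> F (i - j)")
        case True
        have sx: "spow \<sigma> (i - j) x = x" using True by (rule F_fixed)
        then have sj: "spow \<sigma> j x = spow \<sigma> i x" using spow_add[of j "i - j" x] by simp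
        have "x \<in> F (n + (i - j)) \<longleftrightarrow> x \<in> F n"
          using F_diff_iff[OF True, of "n + (i - j)"] by simp
        moreover have "j + (n + (i - j)) = n + i" by simp
        ultimately have "cnj (c j (i - j) x) * c j (n + (i - j)) x =
            (if x \<in> F n then (complex_of_real (w j x))\<^sup>2 * T i else 0)"
          using True by (simp add: c_def T_def sj power2_eq_square)
        then show ?thesis using True by (simp add: sx w2)
      qed (simp add: c_def)
      have "cmult \<sigma> (cstar \<sigma> (c j)) (c j) n x = (\<Sum>\<^sub>\<infinity>i. ?g i)"
        unfolding cstar_cmult_apply
        by (subst infsum_reindex_bij_betw[OF bij, symmetric]) (simp only: *)
      also have "\<dots> = infsum ?g S"
        by (rule infsum_cong_neutral) (auto simp: T_def supp)
      finally show ?thesis using S by simp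
    qed
    have one: "(\<Sum>j\<in>S. if x \<in> F (i - j) then T i / of_nat (N j x) else 0) = T i" if i: "i \<in> S" for i
    proof -
      \<comment> \<open>Equivalent indices have the same class, so the weight can be pulled out of
        the sum over \<open>j\<close>.\<close>
      have Neq: "N j x = N i x" if "x \<in> F (i - j)" for j
      proof -
        have "x \<in> F (k - j) \<longleftrightarrow> x \<in> F (k - i)" for k
          using F_diff_iff[OF that, of "k - j"] by (simp add: algebra_simps)
        then show ?thesis by (simp add: N_def)
      qed
      have "(\<Sum>j\<in>S. if x \<in> F (i - j) then T i / of_nat (N j x) else 0)
          = (\<Sum>j\<in>S. if x \<in> F (i - j) then T i / of_nat (N i x) else 0)"
      proof (rule sum.cong)
        show "(if x \<in> F (i - j) then T i / of_nat (N j x) else 0) = (if x \<in> F (i - j) then T i / of_nat (N i x) else 0)" for j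
          using Neq[of j] by presburger
      qed simp
      also have "\<dots> = of_nat (card {j \<in> S. x \<in> F (i - j)}) * (T i / of_nat (N i x))"
        using S by (simp add: sum.If_cases Collect_conj_eq)
      also have "card {j \<in> S. x \<in> F (i - j)} = N i x"
        unfolding N_def by (subst F_diff_commute) simp
      finally show ?thesis using N1[OF i, of x] by simp
    qed
    have "(\<Sum>j\<in>S. cmult \<sigma> (cstar \<sigma> (c j)) (c j)) n x
        = (\<Sum>j\<in>S. \<Sum>i\<in>S. if x \<in> F n \<and> x \<in> F (i - j) then T i / of_nat (N j x) else 0)"
      by (simp add: sum_cp_apply cT)
    also have "\<dots> = (\<Sum>i\<in>S. \<Sum>j\<in>S. if x \<in> F n \<and> x \<in> F (i - j) then T i / of_nat (N j x) else 0)"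
      by (rule sum.swap)
    also have "\<dots> = (if x \<in> F n then (\<Sum>i\<in>S. T i) else 0)"
      using one by simp
    finally show "E (cmult \<sigma> (cstar \<sigma> l) l) n x = (\<Sum>j\<in>S. cmult \<sigma> (cstar \<sigma> (c j)) (c j)) n x"
      using ET by simp
  qed
qed

text \<open>Membership in the commutant is carried through the induction because a state is additive
  only there.\<close>

lemma state_sum_squares:
  assumes \<phi>: "state \<sigma> \<phi>" and "finite S" and "\<And>j. j \<in> S \<Longrightarrow> c j \<in> comm1 \<sigma>"
  shows "(\<Sum>j\<in>S. cmult \<sigma> (cstar \<sigma> (c j)) (c j)) \<in> comm1 \<sigma>
    \<and> Im (\<phi> (\<Sum>j\<in>S. cmult \<sigma> (cstar \<sigma> (c j)) (c j))) = 0
    \<and> Re (\<phi> (\<Sum>j\<in>S. cmult \<sigma> (cstar \<sigma> (c j)) (c j))) \<ge> 0"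
  using assms(2,3)
proof (induction S)
  case empty
  then show ?case by (simp only: sum.empty comm1_zero state_zero[OF \<phi>]) simp
next
  case (insert j S)
  have cj: "c j \<in> comm1 \<sigma>" using insert by simp
  \<comment> \<open>Being fixed by \<open>E\<close> forces the coefficients to vanish off the sets
    \<open>F k\<close>; this shows that the commutant is closed under the involution.\<close>
  have "cstar \<sigma> (c j) = E (cstar \<sigma> (c j))" using E_comm1_id[OF cj] by (simp add: E_cstar)
  then have "cstar \<sigma> (c j) k x \<noteq> 0 \<Longrightarrow> x \<in> F k" for k x
    by (metis E_def)
  then have "cstar \<sigma> (c j) \<in> comm1 \<sigma>"
    using cstar_l1(1)[OF comm1_l1[OF cj]] by (simp add: comm1_iff)
  then have q: "cmult \<sigma> (cstar \<sigma> (c j)) (c j) \<in> comm1 \<sigma>" using cj by (rule comm1_cmult)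
  let ?s = "\<Sum>j\<in>S. cmult \<sigma> (cstar \<sigma> (c j)) (c j)"
  have s: "?s \<in> comm1 \<sigma>" "Im (\<phi> ?s) = 0" "Re (\<phi> ?s) \<ge> 0"
    using insert.IH insert.prems by blast+
  show ?case
    unfolding sum.insert[OF insert.hyps] state_add[OF \<phi> q s(1)]
    using comm1_add[OF q s(1)] s(2,3) state_square[OF \<phi> cj] by (intro conjI) (simp_all only: plus_complex.sel, auto)
qed

end

section \<open>Positivity of the projection when every \<open>F k\<close> is clopen\<close>

locale closed_fixed_interiors = compact_dynamical_system +
  assumes closed_F: "closed (interior (Fix \<sigma> k))"
begin

lemma E_l1:
  assumes "l \<in> l1"
  shows "E l \<in> l1" "l1norm (E l) \<le> l1norm l"
proof -
  have c: "continuous_on UNIV (E l k)" for k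
    unfolding E_def using closed_F l1_continuous[OF assms] by (intro continuous_on_restrict_clopen) auto
  have n: "norm (E l k x) \<le> supnorm (l k)" for k x
    using l1_norm_le[OF assms, of k x] supnorm_nonneg[OF assms] by (auto simp: E_def)
  show "E l \<in> l1" by (rule l1I[OF c l1_summable[OF assms] n])
  show "l1norm (E l) \<le> l1norm l" 
    unfolding l1norm_def[of l] by (rule l1I[OF c l1_summable[OF assms] n])
qed

lemma E_comm1: "l \<in> l1 \<Longrightarrow> E l \<in> comm1 \<sigma>"
  using E_l1(1)[of l] by (auto simp: comm1_iff E_def)

text \<open>States are not assumed continuous. A finite truncation \<open>t\<close> of
  \<open>l\<close> is handled by sums of squares, and the error is self-adjoint and small, so
  \<open>state_selfadjoint_ge\<close> limits the loss to \<epsilon>.\<close>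

lemma state_E_square:
  assumes \<phi>: "state \<sigma> \<phi>" and l: "l \<in> l1"
  shows "Im (\<phi> (E (cmult \<sigma> (cstar \<sigma> l) l))) = 0 \<and> Re (\<phi> (E (cmult \<sigma> (cstar \<sigma> l) l))) \<ge> 0"
proof -
  let ?P = "cmult \<sigma> (cstar \<sigma> l) l"
  have main: "Im (\<phi> (E ?P)) = 0 \<and> Re (\<phi> (E ?P)) \<ge> - \<epsilon>" if \<epsilon>: "\<epsilon> > 0" for \<epsilon> :: real
  proof -
    \<comment> \<open>Chosen so that twice \<open>l1norm l * \<delta>\<close> is at most
      \<open>\<epsilon> / 4\<close>; the summand 1 avoids division by zero when \<open>l\<close> is
      zero.\<close>
    define \<delta> where "\<delta> = \<epsilon> / (8 * (l1norm l + 1))"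
    have nl: "l1norm l \<ge> 0" by (rule l1norm_nonneg[OF l])
    have \<delta>: "\<delta> > 0" using \<epsilon> nl by (simp add: \<delta>_def)
    have \<delta>l: "2 * (l1norm l * \<delta>) \<le> \<epsilon> / 4"
    proof -
      have "8 * (l1norm l + 1) * \<delta> = \<epsilon>" using nl by (simp add: \<delta>_def)
      then show ?thesis using \<delta> by (simp add: algebra_simps)
    qed
    obtain S where S: "finite S" "dist (\<Sum>k\<in>S. supnorm (l k)) (l1norm l) \<le> \<delta>"
      using infsum_finite_approximation[OF l1_summable[OF l] \<delta>] by (auto simp: l1norm_def)
    define t where "t = (\<lambda>k x. if k \<in> S then l k x else 0)"
    have t: "t \<in> l1" "l1norm t \<le> l1norm l"
    proof -
      have c: "continuous_on UNIV (t k)" for k using l1_continuous[OF l, of k] by (cases "k \<in> S") (auto simp: t_def)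
      have n: "norm (t k x) \<le> supnorm (l k)" for k x
        using l1_norm_le[OF l, of k x] supnorm_nonneg[OF l] by (auto simp: t_def)
      show "t \<in> l1" by (rule l1I[OF c l1_summable[OF l] n])
      show "l1norm t \<le> l1norm l"
        unfolding l1norm_def[of l] by (rule l1I[OF c l1_summable[OF l] n])
    qed
    have r: "l - t \<in> l1" "l1norm (l - t) \<le> \<delta>"
    proof -
      show rl: "l - t \<in> l1" using l t(1) by (rule l1_diff)
      have sm: "(\<lambda>k. supnorm (l k)) summable_on A" for A
        by (rule summable_on_subset_banach[OF l1_summable[OF l]]) auto
      have "l1norm (l - t) = (\<Sum>\<^sub>\<infinity>k\<in>- S. supnorm (l k))"
        unfolding l1norm_def
      proof (rule infsum_cong_neutral)
        show "supnorm ((l - t) k) = 0" if "k \<in> UNIV - (- S)" for k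
        proof -
          have "(l - t) k = (\<lambda>x. 0)" using that by (auto simp: t_def fun_eq_iff)
          then show ?thesis by (simp add: supnorm_def)
        qed
        show "supnorm ((l - t) k) = supnorm (l k)" if "k \<in> UNIV \<inter> - S" for k
        proof -
          have "(l - t) k = l k" using that by (auto simp: t_def fun_eq_iff)
          then show ?thesis by simp
        qed
      qed auto
      moreover have "l1norm l = (\<Sum>k\<in>S. supnorm (l k)) + (\<Sum>\<^sub>\<infinity>k\<in>- S. supnorm (l k))"
        using infsum_Un_disjoint[OF sm[of S] sm[of "- S"]] S(1) by (simp add: l1norm_def)
      ultimately show "l1norm (l - t) \<le> \<delta>"
        using S(2) by (simp add: dist_real_def)
    qed
    let ?Q = "cmult \<sigma> (cstar \<sigma> t) t"
    have ls: "cstar \<sigma> l \<in> l1" "cstar \<sigma> t \<in> l1" "cstar \<sigma> (l - t) \<in> l1"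
      using l t r by (auto intro: cstar_l1)
    have PQl: "?P \<in> l1" "?Q \<in> l1" using l t ls by (auto intro: cmult_l1)
    have PQ: "?P - ?Q = cmult \<sigma> (cstar \<sigma> l) (l - t) + cmult \<sigma> (cstar \<sigma> (l - t)) t"
      using l t ls by (simp add: cstar_diff cmult_diff_left cmult_diff_right)
    have n1: "l1norm (cmult \<sigma> (cstar \<sigma> l) (l - t)) \<le> l1norm l * \<delta>"
      using cmult_l1(2)[OF ls(1) r(1)] mult_mono[OF cstar_l1(2)[OF l] r(2) nl l1norm_nonneg[OF r(1)]] by linarith
    have n2: "l1norm (cmult \<sigma> (cstar \<sigma> (l - t)) t) \<le> l1norm l * \<delta>"
      using cmult_l1(2)[OF ls(3) t(1)] cstar_l1(2)[OF r(1)] r(2) 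
        mult_mono[of "l1norm (cstar \<sigma> (l - t))" \<delta> "l1norm t" "l1norm l"] t(2) \<delta> l1norm_nonneg[OF t(1)]
      by (simp add: mult.commute)
    have "l1norm (?P - ?Q) \<le> l1norm (cmult \<sigma> (cstar \<sigma> l) (l - t)) + l1norm (cmult \<sigma> (cstar \<sigma> (l - t)) t)"
      unfolding PQ by (rule l1_add[OF cmult_l1(1)[OF ls(1) r(1)] cmult_l1(1)[OF ls(3) t(1)]])
    then have "l1norm (?P - ?Q) \<le> \<epsilon> / 4" using n1 n2 \<delta>l by linarith
    then have hn: "l1norm (E (?P - ?Q)) \<le> \<epsilon> / 4"
      using E_l1(2)[OF l1_diff(1)[OF PQl]] by linarith
    have hc: "E (?P - ?Q) \<in> comm1 \<sigma>" using PQl by (intro E_comm1 l1_diff)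
    have hs: "cstar \<sigma> (E (?P - ?Q)) = E (?P - ?Q)"
      by (simp add: cstar_diff cstar_cmult cstar_cstar flip: E_cstar)
    have t0: "t k x = 0" if "k \<notin> S" for k x using that by (simp add: t_def)
    obtain c where c: "\<And>j. j \<in> S \<Longrightarrow> c j \<in> comm1 \<sigma>" "E ?Q = (\<Sum>j\<in>S. cmult \<sigma> (cstar \<sigma> (c j)) (c j))"
      using E_square_eq_sum_squares[OF closed_F S(1) t(1) t0] by blast
    have q: "Im (\<phi> (E ?Q)) = 0 \<and> Re (\<phi> (E ?Q)) \<ge> 0"
      unfolding c(2) using state_sum_squares[OF \<phi> S(1), of c] c(1) by blast
    have "\<phi> (E ?P) = \<phi> (E (?P - ?Q)) + \<phi> (E ?Q)"
      using state_add[OF \<phi> hc E_comm1[OF PQl(2)]] by (simp add: E_diff)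
    then show ?thesis using q state_selfadjoint_ge[OF \<phi> hc hs hn \<epsilon>] by simp
  qed
  have "0 \<le> Re (\<phi> (E ?P))"
  proof (rule field_le_epsilon)
    show "0 \<le> Re (\<phi> (E ?P)) + e" if "e > 0" for e using main[OF that] by linarith
  qed
  then show ?thesis using main[of 1] by simp
qed

lemma state_E_poscone:
  assumes \<phi>: "state \<sigma> \<phi>" and "p \<in> poscone \<sigma>"
  shows "Im (\<phi> (E p)) = 0 \<and> Re (\<phi> (E p)) \<ge> 0"
  using assms(2)
proof (induction rule: poscone.induct)
  case zero
  then show ?case unfolding zero_cp E_zero state_zero[OF \<phi>] by simp
next
  case (step l p)
  have "\<phi> (E (cadd (cmult \<sigma> (cstar \<sigma> l) l) p)) = \<phi> (E (cmult \<sigma> (cstar \<sigma> l) l)) + \<phi> (E p)"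
    unfolding cadd_eq_plus E_add
    using step(1) poscone_l1[OF step(2)] by (intro state_add[OF \<phi>] E_comm1 cmult_l1 cstar_l1)
  then show ?case using state_E_square[OF \<phi> step(1)] step.IH by simp
qed

lemma E_c00: "E ` c00 = comm00 \<sigma>"
proof
  show "E ` c00 \<subseteq> comm00 \<sigma>"
  proof clarify
    fix l :: "'a cp" assume l: "l \<in> c00"
    have "{k. E l k \<noteq> (\<lambda>x. 0)} \<subseteq> {k. l k \<noteq> (\<lambda>x. 0)}" by (auto simp: E_def)
    then have "finite {k. E l k \<noteq> (\<lambda>x. 0)}" using l by (auto simp: c00_def intro: finite_subset)
    then show "E l \<in> comm00 \<sigma>" using l E_comm1[of l] E_l1[of l] by (simp add: comm00_def c00_def)
  qed
  show "comm00 \<sigma> \<subseteq> E ` c00"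
    using E_comm1_id by (force simp: comm00_def)
qed

end

context compact_dynamical_system
begin

subsection \<open>One-sided module maps\<close>

text \<open>Off \<open>F k\<close> the coefficient \<open>g k\<close> vanishes, so
  \<open>F k\<close> is exactly the level set of the value 1 of a continuous function.\<close>

lemma closed_F_if_unit:
  assumes "g \<in> comm1 \<sigma>" and "\<And>x. x \<in> F k \<Longrightarrow> g k x = 1"
  shows "closed (F k)"
proof -
  have "F k = {x. g k x = 1}"
    using assms comm1_F[OF assms(1)] by force
  moreover have "closed {x. g k x = 1}"
    using l1_continuous[OF comm1_l1[OF assms(1)], of k] by (intro closed_Collect_eq continuous_on_const)
  ultimately show ?thesis by simp
qed

text \<open>For \<open>f\<close> vanishing off \<open>F k\<close>, the product of \<open>f\<close>
  and \<open>\<delta>\<close> lies in the commutant and is fixed by \<open>E'\<close>. The module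
  property then gives \<open>f x * E' \<delta> k x = f x\<close>, with \<open>f x = 1\<close> at the
  chosen point.\<close>

lemma F_closed_if_left_module_map:
  assumes r: "E' ` c00 \<subseteq> comm1 \<sigma>" and i: "\<forall>l\<in>comm00 \<sigma>. E' l = l"
    and m: "\<forall>f\<in>CX. \<forall>l\<in>c00. E' (cmult \<sigma> (emb f) l) = cmult \<sigma> (emb f) (E' l)"
  shows "closed (F k)"
proof -
  define \<delta> :: "'a cp" where "\<delta> = (\<lambda>n. if n = k then (\<lambda>x. 1) else (\<lambda>x. 0))"
  have \<delta>: "\<delta> \<in> c00" unfolding \<delta>_def by (rule monomial_c00) (simp add: CX_def)
  show ?thesis
  proof (rule closed_F_if_unit)
    show "E' \<delta> \<in> comm1 \<sigma>" using r \<delta> by blast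
    fix x assume "x \<in> F k"
    then obtain f where f: "f \<in> CX" "f x = 1" "\<And>y. y \<notin> F k \<Longrightarrow> f y = 0"
      by (metis Urysohn_point open_interior)
    have eq: "cmult \<sigma> (emb f) \<delta> = (\<lambda>n. if n = k then f else (\<lambda>x. 0))"
      by (auto simp: fun_eq_iff cmult_emb_left \<delta>_def)
    have "cmult \<sigma> (emb f) \<delta> \<in> comm00 \<sigma>"
      unfolding eq using monomial_c00[OF f(1), of k] f(3) by (auto simp: comm00_def comm1_iff c00_def)
    then have "cmult \<sigma> (emb f) (E' \<delta>) = cmult \<sigma> (emb f) \<delta>" using i m f(1) \<delta> by metis
    then have "cmult \<sigma> (emb f) (E' \<delta>) k x = cmult \<sigma> (emb f) \<delta> k x" by simp
    then show "E' \<delta> k x = 1" by (simp add: cmult_emb_left f(2) \<delta>_def)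
  qed
qed

lemma F_closed_if_right_module_map:
  assumes r: "E' ` c00 \<subseteq> comm1 \<sigma>" and i: "\<forall>l\<in>comm00 \<sigma>. E' l = l"
    and m: "\<forall>f\<in>CX. \<forall>l\<in>c00. E' (cmult \<sigma> l (emb f)) = cmult \<sigma> (E' l) (emb f)"
  shows "closed (F k)"
proof -
  define \<delta> :: "'a cp" where "\<delta> = (\<lambda>n. if n = k then (\<lambda>x. 1) else (\<lambda>x. 0))"
  have \<delta>: "\<delta> \<in> c00" unfolding \<delta>_def by (rule monomial_c00) (simp add: CX_def)
  show ?thesis
  proof (rule closed_F_if_unit)
    show "E' \<delta> \<in> comm1 \<sigma>" using r \<delta> by blast
    fix x assume x: "x \<in> F k"
    then obtain f where f: "f \<in> CX" "f x = 1" "\<And>y. y \<notin> F k \<Longrightarrow> f y = 0"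
      by (metis Urysohn_point open_interior)
    \<comment> \<open>Right multiplication twists \<open>f\<close> by
      \<open>spow \<sigma> (- k)\<close>. The twist is invisible: this map fixes \<open>F k\<close>
      pointwise and preserves its complement, where \<open>f\<close> is zero.\<close>
    have f0: "f (spow \<sigma> (- k) y) = f y" for y
      using F_fixed_minus[of y k] f(3)[of y] f(3)[of "spow \<sigma> (- k) y"] by (cases "y \<in> F k") auto
    have eq: "cmult \<sigma> \<delta> (emb f) = (\<lambda>n. if n = k then f else (\<lambda>x. 0))"
      by (auto simp: fun_eq_iff cmult_emb_right \<delta>_def f0)
    have "cmult \<sigma> \<delta> (emb f) \<in> comm00 \<sigma>"
      unfolding eq using monomial_c00[OF f(1), of k] f(3) by (auto simp: comm00_def comm1_iff c00_def)
    then have "cmult \<sigma> (E' \<delta>) (emb f) = cmult \<sigma> \<delta> (emb f)" using i m f(1) \<delta> by metis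
    then have "cmult \<sigma> (E' \<delta>) (emb f) k x = cmult \<sigma> \<delta> (emb f) k x" by simp
    then show "E' \<delta> k x = 1" by (simp add: cmult_emb_right f0 f(2) \<delta>_def)
  qed
qed

end

section \<open>The equivalences\<close>

theorem theorem5p6:
  fixes \<sigma> \<tau> :: "'a::t2_space \<Rightarrow> 'a"
  assumes "compact (UNIV :: 'a set)"
    and "homeomorphism (UNIV :: 'a set) UNIV \<sigma> \<tau>"
  defines "P1 \<equiv> (\<exists>E'. lin_on c00 E' \<and> E' ` c00 \<subseteq> comm1 \<sigma>
                 \<and> (\<forall>l\<in>comm00 \<sigma>. E' l = l)
                 \<and> (\<forall>f\<in>CX. \<forall>l\<in>c00. E' (cmult \<sigma> (emb f) l) = cmult \<sigma> (emb f) (E' l)))"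
    and "P2 \<equiv> (\<exists>E'. lin_on c00 E' \<and> E' ` c00 \<subseteq> comm1 \<sigma>
                 \<and> (\<forall>l\<in>comm00 \<sigma>. E' l = l)
                 \<and> (\<forall>f\<in>CX. \<forall>l\<in>c00. E' (cmult \<sigma> l (emb f)) = cmult \<sigma> (E' l) (emb f)))"
    and "P3 \<equiv> (\<forall>k::int. closed (interior (Fix \<sigma> k)))"
    and "P4 \<equiv> (\<exists>E'. lin_on l1 E' \<and> E' ` l1 = comm1 \<sigma>
                 \<and> (\<forall>l\<in>l1. E' (E' l) = E' l)
                 \<and> (\<forall>p\<in>poscone \<sigma>. E' p = (\<lambda>k x. 0) \<longrightarrow> p = (\<lambda>k x. 0))
                 \<and> (\<forall>l\<in>l1. E' (cstar \<sigma> l) = cstar \<sigma> (E' l))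
                 \<and> (\<forall>l\<in>l1. l1norm (E' l) \<le> l1norm l)
                 \<and> (\<exists>l\<in>l1. l \<noteq> (\<lambda>k x. 0) \<and> l1norm (E' l) = l1norm l)
                 \<and> (\<forall>a\<in>comm1 \<sigma>. \<forall>b\<in>comm1 \<sigma>. \<forall>l\<in>l1.
                       E' (cmult \<sigma> (cmult \<sigma> a l) b) = cmult \<sigma> (cmult \<sigma> a (E' l)) b)
                 \<and> E' ` c00 = comm00 \<sigma>
                 \<and> (\<forall>\<phi>. state \<sigma> \<phi> \<longrightarrow> (\<forall>p\<in>poscone \<sigma>.
                       Im (\<phi> (E' p)) = 0 \<and> Re (\<phi> (E' p)) \<ge> 0)))"
  shows "(P1 \<longleftrightarrow> P3) \<and> (P2 \<longleftrightarrow> P3) \<and> (P4 \<longleftrightarrow> P3)"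
proof -
  interpret compact_dynamical_system \<sigma> \<tau>
    using assms(1,2) by unfold_locales
  have 13: "P1 \<Longrightarrow> P3"
    unfolding P1_def P3_def using F_closed_if_left_module_map by blast
  have 23: "P2 \<Longrightarrow> P3"
    unfolding P2_def P3_def using F_closed_if_right_module_map by blast
  have 34: P4 if P3
  proof -
    interpret closed_fixed_interiors \<sigma> \<tau>
      using that unfolding P3_def by unfold_locales auto
    have lin: "lin_on l1 E"
      unfolding lin_on_def cadd_eq_plus by (simp only: E_add E_cscale) simp
    have range: "E ` l1 = comm1 \<sigma>"
      using E_comm1 E_comm1_id comm1_l1 by (metis image_subset_iff image_eqI subsetI subset_antisym)
    have faithful: "p = (\<lambda>k x. 0)" if "p \<in> poscone \<sigma>" "E p = (\<lambda>k x. 0)" for p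
    proof -
      \<comment> \<open>\<open>F 0\<close> is the whole space, so \<open>E\<close> leaves the
        coefficient at degree 0 unchanged.\<close>
      have "p 0 x = 0" for x using fun_cong[OF fun_cong[OF that(2), of 0], of x] by (simp add: E_def)
      then show ?thesis using poscone_0[OF that(1)] unfolding zero_cp by blast
    qed
    \<comment> \<open>The unit is fixed by \<open>E\<close> and nonzero, so the contraction bound is
      attained and the norm is exactly one.\<close>
    have norm1: "\<exists>l\<in>l1. l \<noteq> (\<lambda>k x. 0) \<and> l1norm (E l) = l1norm l"
    proof (intro bexI conjI)
      show "l1norm (E cone) = l1norm (cone :: 'a cp)" by (simp only: E_comm1_id[OF cone_comm1])
      have "cone 0 (undefined :: 'a) = 1" by (simp add: cone_def emb_def)
      then show "(cone :: 'a cp) \<noteq> (\<lambda>k x. 0)" by (metis zero_neq_one)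
    qed (rule comm1_l1[OF cone_comm1])
    show P4
      unfolding P4_def
      by (intro exI[of _ E] conjI ballI allI impI lin range norm1 E_c00)
        (auto simp only: E_idem E_cstar E_l1 E_cmult_left E_cmult_right state_E_poscone intro: faithful)
  qed
  \<comment> \<open>One map serves (1) and (2): each one-sided property comes from the bimodule
    property with \<open>cone\<close> on the other side.\<close>
  have 4: "\<exists>E'. lin_on c00 E' \<and> E' ` c00 \<subseteq> comm1 \<sigma> \<and> (\<forall>l\<in>comm00 \<sigma>. E' l = l)
      \<and> (\<forall>f\<in>CX. \<forall>l\<in>c00. E' (cmult \<sigma> (emb f) l) = cmult \<sigma> (emb f) (E' l))
      \<and> (\<forall>f\<in>CX. \<forall>l\<in>c00. E' (cmult \<sigma> l (emb f)) = cmult \<sigma> (E' l) (emb f))" if P4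
  proof -
    obtain E' where E': "lin_on l1 E'" "E' ` l1 = comm1 \<sigma>" "\<forall>l\<in>l1. E' (E' l) = E' l"
      "\<forall>a\<in>comm1 \<sigma>. \<forall>b\<in>comm1 \<sigma>. \<forall>l\<in>l1. E' (cmult \<sigma> (cmult \<sigma> a l) b) = cmult \<sigma> (cmult \<sigma> a (E' l)) b"
      using \<open>P4\<close> unfolding P4_def by (elim exE conjE) (rule that; assumption)
    have c00: "c00 \<subseteq> (l1 :: 'a cp set)" by (auto simp: c00_def)
    have "lin_on c00 E'" using E'(1) c00 unfolding lin_on_def by blast
    moreover have "E' ` c00 \<subseteq> comm1 \<sigma>" using E'(2) c00 by blast
    moreover have "\<forall>l\<in>comm00 \<sigma>. E' l = l"
    proof
      fix l assume "l \<in> comm00 \<sigma>"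
      then have "l \<in> E' ` l1" by (simp add: comm00_def E'(2))
      then show "E' l = l" using E'(3) by auto
    qed
    moreover have "E' (cmult \<sigma> (emb f) l) = cmult \<sigma> (emb f) (E' l)" if "f \<in> CX" "l \<in> c00" for f l
      using E'(4)[rule_format, OF emb_comm1[OF that(1)] cone_comm1, of l] that(2) c00 by (auto simp: cone_cmult)
    moreover have "E' (cmult \<sigma> l (emb f)) = cmult \<sigma> (E' l) (emb f)" if "f \<in> CX" "l \<in> c00" for f l
      using E'(4)[rule_format, OF cone_comm1 emb_comm1[OF that(1)], of l] that(2) c00 by (auto simp: cone_cmult)
    ultimately show ?thesis by blast
  qed
  have 41: "P4 \<Longrightarrow> P1" unfolding P1_def using 4 by blast
  have 42: "P4 \<Longrightarrow> P2" unfolding P2_def using 4 by blast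
  show ?thesis using 13 23 34 41 42 by blast
qed

end
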